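(* Let $K$ be a field with an absolute value, $\varphi\in K(T)$ of degree $d\ge2$, with lift $F$ as in the context. Let $N=td^k$ with integers $2\le t\le 2d-1$ and $k\ge1$, and let $z_1,\ldots,z_N$ be nonzero elements of the filled Julia set $K_F$ whose images in $\mathbb{P}^1(K)$ are pairwise distinct. Let $R(F)$ be the smallest radius such that $K_F\subseteq\{z\in K^2:\|z\|\le R(F)\}$. Then \[ \sum_{i\neq j} -\log|z_i\wedge z_j| \;\ge\; r(F)N^2 - \epsilon_K N\log N - 2(\log R(F))\,\alpha N - r(F)(1+\alpha)N, \] where $\alpha = t-1+(d-1)k>0$ satisfies $2\le\alpha\le (d-1)(\log_d N+2)$.
   Context: Write $\varphi([z_0:z_1]) = [F_1(z_0,z_1):F_2(z_0,z_1)]$ with $F_1,F_2 \in K[x,y]$ homogeneous of degree $d$ with no common linear factor over an algebraic closure of $K$, and $F=(F_1,F_2):K^2\to K^2$ with iterates $F^{(n)}$. $\operatorname{Res}(F)$ is the homogeneous resultant of $F_1,F_2$ and $r(F)=\frac{1}{d(d-1)}\log|\operatorname{Res}(F)|$. For $z=(z_0,z_1)$, $\|z\|=\max(|z_0|,|z_1|)$, and $z\wedge w = z_0w_1-z_1w_0$. The filled Julia set is $K_F=\{z\in K^2 : \{F^{(n)}(z)\}_{n\ge0}\text{ is bounded}\}$. $\epsilon_K=0$ if the absolute value is non-archimedean and $\epsilon_K=1$ if it is archimedean. *)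

theory Defs
  imports Complex_Main
    "HOL-Computational_Algebra.Fraction_Field"
    "HOL-Algebra.Algebraic_Closure_Type"
    "Subresultants.Resultant_Prelim"
begin



definition absolute_value :: "('a::field \<Rightarrow> real) \<Rightarrow> bool" where
  "absolute_value av \<longleftrightarrow>
     (\<forall>x. av x \<ge> 0) \<and> (\<forall>x. av x = 0 \<longleftrightarrow> x = 0) \<and>
     (\<forall>x y. av (x * y) = av x * av y) \<and> (\<forall>x y. av (x + y) \<le> av x + av y)"

definition nonarchimedean :: "('a::field \<Rightarrow> real) \<Rightarrow> bool" where
  "nonarchimedean av \<longleftrightarrow> (\<forall>x y. av (x + y) \<le> max (av x) (av y))"

definition eps :: "('a::field \<Rightarrow> real) \<Rightarrow> real" where
  "eps av = (if nonarchimedean av then 0 else 1)"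


text \<open>
  The ring \<open>K[x,y]\<close> is represented as \<open>K[y][x]\<close>, so \<open>coeff (coeff P i) j\<close> is the
  coefficient of \<open>x^i y^j\<close>.
\<close>

definition eval2 :: "'a::field poly poly \<Rightarrow> 'a \<Rightarrow> 'a \<Rightarrow> 'a" where
  "eval2 P a b = poly (poly P [:a:]) b"

definition homogeneous :: "nat \<Rightarrow> 'a::field poly poly \<Rightarrow> bool" where
  "homogeneous d P \<longleftrightarrow> (\<forall>i j. coeff (coeff P i) j \<noteq> 0 \<longrightarrow> i + j = d)"

text \<open>The polynomial \<open>a x + b y\<close>.\<close>

definition linear_form :: "'a::field \<Rightarrow> 'a \<Rightarrow> 'a poly poly" where
  "linear_form a b = [:[:0, b:], [:a:]:]"

definition common_linear_factor_ac :: "'a::field poly poly \<Rightarrow> 'a poly poly \<Rightarrow> bool" where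
  "common_linear_factor_ac P Q \<longleftrightarrow>
     (\<exists>a b :: 'a alg_closure. (a, b) \<noteq> (0, 0) \<and>
        linear_form a b dvd map_poly (map_poly to_ac) P \<and>
        linear_form a b dvd map_poly (map_poly to_ac) Q)"

text \<open>The univariate polynomial \<open>P(T, 1)\<close>.\<close>

definition dehom :: "'a::field poly poly \<Rightarrow> 'a poly" where
  "dehom P = map_poly (\<lambda>c. poly c 1) P"

text \<open>
  The Sylvester determinant for the formal degrees \<open>(d, d)\<close>: the \<open>i\<close>-th coefficient of
  \<open>dehom P\<close> is the coefficient of \<open>x^i y^(d-i)\<close>.  The formal degree matters, since
  \<open>dehom P\<close> may have degree less than \<open>d\<close>.
\<close>

definition hom_resultant :: "nat \<Rightarrow> 'a::field poly poly \<Rightarrow> 'a poly poly \<Rightarrow> 'a" where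
  "hom_resultant d P Q = resultant_sub d d (dehom P) (dehom Q)"


text \<open>The degree of a rational function, read off from a representation in lowest terms.\<close>

definition ratfun_has_degree :: "'a::field poly fract \<Rightarrow> nat \<Rightarrow> bool" where
  "ratfun_has_degree \<phi> d \<longleftrightarrow>
     (\<exists>p q. q \<noteq> 0 \<and> coprime p q \<and> \<phi> = Fract p q \<and> d = max (degree p) (degree q))"

text \<open>
  \<open>(F1, F2)\<close> is a homogeneous lift of \<open>\<phi>\<close>, where the affine coordinate is \<open>T = z0 / z1\<close>
  and likewise for the value: \<open>\<phi>(T) = F1(T, 1) / F2(T, 1)\<close>.
\<close>

definition is_lift ::
  "nat \<Rightarrow> 'a::field poly fract \<Rightarrow> 'a poly poly \<Rightarrow> 'a poly poly \<Rightarrow> bool" where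
  "is_lift d \<phi> F1 F2 \<longleftrightarrow>
     homogeneous d F1 \<and> homogeneous d F2 \<and> \<not> common_linear_factor_ac F1 F2 \<and>
     \<phi> = Fract (dehom F1) (dehom F2)"

definition lift_map :: "'a::field poly poly \<Rightarrow> 'a poly poly \<Rightarrow> 'a \<times> 'a \<Rightarrow> 'a \<times> 'a" where
  "lift_map F1 F2 z = (eval2 F1 (fst z) (snd z), eval2 F2 (fst z) (snd z))"

definition r_const :: "('a::field \<Rightarrow> real) \<Rightarrow> nat \<Rightarrow> 'a poly poly \<Rightarrow> 'a poly poly \<Rightarrow> real" where
  "r_const av d F1 F2 = 1 / (real d * (real d - 1)) * ln (av (hom_resultant d F1 F2))"

definition vnorm :: "('a::field \<Rightarrow> real) \<Rightarrow> 'a \<times> 'a \<Rightarrow> real" where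
  "vnorm av z = max (av (fst z)) (av (snd z))"

definition wedge :: "'a::field \<times> 'a \<Rightarrow> 'a \<times> 'a \<Rightarrow> 'a" where
  "wedge z w = fst z * snd w - snd z * fst w"

definition filled_julia ::
  "('a::field \<Rightarrow> real) \<Rightarrow> 'a poly poly \<Rightarrow> 'a poly poly \<Rightarrow> ('a \<times> 'a) set" where
  "filled_julia av F1 F2 = {z. \<exists>B. \<forall>n. vnorm av ((lift_map F1 F2 ^^ n) z) \<le> B}"

text \<open>
  The least radius exists for a lift of degree at least 2: the filled Julia set contains the
  origin and is bounded, so it is the supremum of \<open>vnorm av\<close> on that set.
\<close>

definition julia_radius ::
  "('a::field \<Rightarrow> real) \<Rightarrow> 'a poly poly \<Rightarrow> 'a poly poly \<Rightarrow> real" where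
  "julia_radius av F1 F2 = (LEAST R. filled_julia av F1 F2 \<subseteq> {z. vnorm av z \<le> R})"

text \<open>For \<open>z \<noteq> (0, 0)\<close> this is the point of \<open>P^1(K)\<close> given by \<open>z\<close>, as a punctured line.\<close>

definition proj_point :: "'a::field \<times> 'a \<Rightarrow> ('a \<times> 'a) set" where
  "proj_point z = {(c * fst z, c * snd z) |c. c \<noteq> 0}"

end

(* Let H_1, ..., H_N be the forms of degree N - 1 obtained as products of components of the
   iterates F^(0), ..., F^(k), with d - 1 factors from each F^(l), l < k, and t - 1 factors from F^(k).
   On the filled Julia set every |H_l| is at most R(F)^alpha, so Hadamard's inequality bounds
   |det (H_l(z_i))|^2 by N^N R(F)^(2 alpha N), without the factor N^N in the non-archimedean case.
   This determinant is the product of the Vandermonde determinant of the z_i, which is the product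
   of the wedges z_i /\ z_j with i < j, and the determinant of the H_l with respect to the
   monomials, which is a power of the resultant of F up to sign. Hadamard's inequality is moved
   from the complex numbers to an arbitrary absolute value by applying the triangle inequality to
   high powers of the determinant polynomial. *)

theory Submission
  imports Defs
begin

section \<open>Determinants of functions on indices\<close>

text \<open>The shape \<open>N = t * d ^ k\<close> comes from writing an index below N with k digits
  in base d and a leading digit below t: each digit tells how many of the factors taken from one
  iterate are its first component. The degrees add up to (d-1)(1 + d + ... + d^(k-1)) + (t-1)d^k =
  N-1, so there are as many products as monomials, and \<alpha> = (t-1) + (d-1)k is the number of
  factors.

  Passing from level k to k+1 raises the determinant to the power d and multiplies it by the
  resultant to the power n(n-1)/2, where n = t d^k. For the exponent e this recursion gives 2d(d-1)e
  = N^2 - (1+\<alpha>)N, which explains both the normalisation of r(F) and the last term of the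
  bound. Since the sum over i \<noteq> j counts each pair twice, the squared form of Hadamard's
  inequality is the one that fits.

  The obstacle is that a general K has no inner product in which to orthogonalise; the link to the
  complex numbers is that the determinant has integer coefficients.\<close>

definition fdet :: "nat \<Rightarrow> (nat \<Rightarrow> nat \<Rightarrow> 'a) \<Rightarrow> 'a::comm_ring_1" where
  "fdet n A = det (mat n n (\<lambda>(i, j). A i j))"

lemma fdet_eq_sum:
  "fdet n A = (\<Sum>p | p permutes {0..<n}. signof p * (\<Prod>i = 0..<n. A i (p i)))"
proof -
  have "fdet n A = (\<Sum>p | p permutes {0..<n}. signof p *
      (\<Prod>i = 0..<n. mat n n (\<lambda>(i, j). A i j) $$ (i, p i)))"
    unfolding fdet_def by (subst det_def'[of _ n]) auto
  also have "\<dots> = (\<Sum>p | p permutes {0..<n}. signof p * (\<Prod>i = 0..<n. A i (p i)))"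
    by (intro sum.cong refl arg_cong2[where f = "(*)"] prod.cong)
       (auto dest: permutes_in_image)
  finally show ?thesis .
qed

lemma fdet_cong:
  assumes "\<And>i j. i < n \<Longrightarrow> j < n \<Longrightarrow> A i j = B i j"
  shows "fdet n A = fdet n B"
  unfolding fdet_def using assms by (intro arg_cong[where f = det]) auto

lemma fdet_transpose: "fdet n (\<lambda>i j. A j i) = fdet n A"
  unfolding fdet_def
  by (subst det_transpose[of "mat n n (\<lambda>(i, j). A i j)" n, symmetric])
     (auto intro!: arg_cong[where f = det])

lemma fdet_mult:
  "fdet n (\<lambda>i j. \<Sum>k<n. A i k * B k j) = fdet n A * fdet n B"
  unfolding fdet_def
  by (subst det_mult[of _ n, symmetric])
     (auto intro!: arg_cong[where f = det] sum.cong simp: scalar_prod_def lessThan_atLeast0)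

lemma fdet_permute_rows:
  assumes "p permutes {0..<n}"
  shows "fdet n (\<lambda>i j. A (p i) j) = signof p * fdet n A"
  unfolding fdet_def using assms
  by (subst det_permute_rows[symmetric, of _ n p])
     (auto intro!: arg_cong[where f = det] dest: permutes_in_image)

lemma fdet_permute_cols:
  assumes "p permutes {0..<n}"
  shows "fdet n (\<lambda>i j. A i (p j)) = signof p * fdet n A"
  using fdet_permute_rows[OF assms, of "\<lambda>i j. A j i"]
  by (simp add: fdet_transpose[of n "\<lambda>i j. A i (p j)", symmetric] fdet_transpose[of n A])

lemma fdet_lower_triangular:
  assumes "\<And>i j. i < j \<Longrightarrow> j < n \<Longrightarrow> A i j = 0"
  shows "fdet n A = (\<Prod>i<n. A i i)"
  unfolding fdet_def using assms
  by (subst det_lower_triangular[of n])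
     (auto simp: diag_mat_def prod.list_conv_set_nth lessThan_atLeast0
        simp flip: prod.distinct_set_conv_list intro!: prod.cong)

lemma fdet_block_lower:
  fixes A :: "nat \<Rightarrow> nat \<Rightarrow> 'a::idom"
  assumes "\<And>i j. i < p \<Longrightarrow> j < q \<Longrightarrow> A i (p + j) = 0"
  shows "fdet (p + q) A = fdet p A * fdet q (\<lambda>i j. A (p + i) (p + j))"
proof -
  have "fdet (p + q) A = det (four_block_mat (mat p p (\<lambda>(i, j). A i j)) (0\<^sub>m p q)
      (mat q p (\<lambda>(i, j). A (p + i) j)) (mat q q (\<lambda>(i, j). A (p + i) (p + j))))"
    unfolding fdet_def
  proof (intro arg_cong[where f = det] eq_matI)
    fix i j
    assume "i < dim_row (four_block_mat (mat p p (\<lambda>(i, j). A i j)) (0\<^sub>m p q)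
      (mat q p (\<lambda>(i, j). A (p + i) j)) (mat q q (\<lambda>(i, j). A (p + i) (p + j))))"
      "j < dim_col (four_block_mat (mat p p (\<lambda>(i, j). A i j)) (0\<^sub>m p q)
      (mat q p (\<lambda>(i, j). A (p + i) j)) (mat q q (\<lambda>(i, j). A (p + i) (p + j))))"
    then show "mat (p + q) (p + q) (\<lambda>(i, j). A i j) $$ (i, j) =
      four_block_mat (mat p p (\<lambda>(i, j). A i j)) (0\<^sub>m p q)
      (mat q p (\<lambda>(i, j). A (p + i) j)) (mat q q (\<lambda>(i, j). A (p + i) (p + j))) $$ (i, j)"
      using assms[of i "j - p"] by auto
  qed auto
  then show ?thesis
    by (subst (asm) det_four_block_mat_upper_right_zero) (auto simp: fdet_def)
qed

lemma fdet_block_upper: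
  fixes A :: "nat \<Rightarrow> nat \<Rightarrow> 'a::idom"
  assumes "\<And>i j. i < q \<Longrightarrow> j < p \<Longrightarrow> A (p + i) j = 0"
  shows "fdet (p + q) A = fdet p A * fdet q (\<lambda>i j. A (p + i) (p + j))"
  using fdet_block_lower[of p q "\<lambda>i j. A j i"] assms
  by (simp add: fdet_transpose[of _ A]
      fdet_transpose[of _ "\<lambda>i j. A (p + i) (p + j)", symmetric])

lemma fdet_one: "fdet n (\<lambda>i j. if i = j then 1 else 0) = 1"
  by (subst fdet_lower_triangular) auto

lemma fdet_scale_rows:
  "fdet n (\<lambda>i j. c i * A i j) = (\<Prod>i<n. c i) * fdet n A"
  by (simp add: fdet_eq_sum prod.distrib sum_distrib_left lessThan_atLeast0 mult_ac)

section \<open>Hadamard's inequality over the complex numbers\<close>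

text \<open>The standard Hermitian product, conjugate-linear in the second argument.\<close>

definition cip :: "nat \<Rightarrow> (nat \<Rightarrow> complex) \<Rightarrow> (nat \<Rightarrow> complex) \<Rightarrow> complex" where
  "cip n u v = (\<Sum>k<n. u k * cnj (v k))"

lemma cip_cnj: "cnj (cip n u v) = cip n v u"
  by (simp add: cip_def mult.commute)

lemma cip_add_left: "cip n (\<lambda>k. u k + v k) w = cip n u w + cip n v w"
  by (simp add: cip_def algebra_simps sum.distrib)

lemma cip_add_right: "cip n w (\<lambda>k. u k + v k) = cip n w u + cip n w v"
  by (simp add: cip_def algebra_simps sum.distrib)

lemma cip_diff_left: "cip n (\<lambda>k. u k - v k) w = cip n u w - cip n v w"
  by (simp add: cip_def algebra_simps sum_subtractf)

lemma cip_sum_left: "cip n (\<lambda>k. \<Sum>l\<in>S. c l * B l k) w = (\<Sum>l\<in>S. c l * cip n (B l) w)"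
proof -
  have "cip n (\<lambda>k. \<Sum>l\<in>S. c l * B l k) w = (\<Sum>k<n. \<Sum>l\<in>S. c l * (B l k * cnj (w k)))"
    by (simp add: cip_def sum_distrib_right mult.assoc)
  also have "\<dots> = (\<Sum>l\<in>S. \<Sum>k<n. c l * (B l k * cnj (w k)))"
    by (rule sum.swap)
  finally show ?thesis by (simp add: cip_def sum_distrib_left)
qed

lemma cip_self: "cip n u u = of_real (\<Sum>k<n. (cmod (u k))\<^sup>2)"
  by (simp only: cip_def of_real_sum complex_norm_square)

lemma cip_self_eq_0:
  assumes "cip n u u = 0" shows "cip n v u = 0"
proof -
  have "(\<Sum>k<n. (cmod (u k))\<^sup>2) = 0"
    using assms unfolding cip_self of_real_eq_0_iff .
  then have "\<forall>k<n. u k = 0"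
    by (subst (asm) sum_nonneg_eq_0_iff) auto
  then show ?thesis by (simp add: cip_def)
qed

text \<open>Gram-Schmidt without normalisation: replacing row k by its component orthogonal to the
  earlier rows is a unipotent row operation, and by Pythagoras it cannot lengthen the row. Rows may
  be dependent.\<close>

lemma orthogonal_rows_exist:
  assumes "k \<le> n"
  shows "\<exists>B. fdet n B = fdet n A
    \<and> (\<forall>i<n. (\<Sum>m<n. (cmod (B i m))\<^sup>2) \<le> (\<Sum>m<n. (cmod (A i m))\<^sup>2))
    \<and> (\<forall>i<k. \<forall>j<i. cip n (B i) (B j) = 0)"
  using assms
proof (induction k)
  case 0
  show ?case by (rule exI[of _ A]) auto
next
  case (Suc k)
  then obtain B where B: "fdet n B = fdet n A"
    "\<And>i. i < n \<Longrightarrow> (\<Sum>m<n. (cmod (B i m))\<^sup>2) \<le> (\<Sum>m<n. (cmod (A i m))\<^sup>2)"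
    "\<And>i j. i < k \<Longrightarrow> j < i \<Longrightarrow> cip n (B i) (B j) = 0"
    by auto
  have orth: "cip n (B i) (B j) = 0" if "i < k" "j < k" "i \<noteq> j" for i j
    using B(3)[of i j] B(3)[of j i] that cip_cnj[of n "B i" "B j"]
    by (cases "j < i") (auto simp: complex_cnj_zero_iff[of "cip n (B i) (B j)"] not_less)
  \<comment> \<open>If row l is zero, division by zero gives the coefficient 0, and
    \<open>cip_self_eq_0\<close> shows that this is the right one.\<close>
  define c where "c l = cip n (B k) (B l) / cip n (B l) (B l)" for l
  define S where "S m = (\<Sum>l<k. c l * B l m)" for m
  \<comment> \<open>Left multiplication by \<open>L\<close> subtracts the projection
    \<open>S\<close> from row k.\<close>
  define L where "L i m = (if i = m then 1 else if i = k \<and> m < k then - c m else 0)" for i m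
  define B' where "B' i m = (if i = k then B k m - S m else B i m)" for i m
  have S_ip: "cip n S (B j) = cip n (B k) (B j)" if "j < k" for j
  proof -
    have "cip n S (B j) = (\<Sum>l<k. c l * cip n (B l) (B j))"
      unfolding S_def[abs_def] by (rule cip_sum_left)
    also have "\<dots> = c j * cip n (B j) (B j)"
      using that by (subst sum.remove[of _ j]) (auto simp: orth intro!: sum.neutral)
    also have "\<dots> = cip n (B k) (B j)"
      using cip_self_eq_0[of n "B j" "B k"] by (auto simp: c_def)
    finally show ?thesis .
  qed
  have B'k: "cip n (B' k) (B j) = 0" if "j < k" for j
    using S_ip[OF that] by (simp add: B'_def[abs_def] cip_diff_left)
  have "fdet n (\<lambda>i j. \<Sum>m<n. L i m * B m j) = fdet n L * fdet n B"
    by (rule fdet_mult)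
  also have "fdet n L = 1"
    by (subst fdet_lower_triangular) (auto simp: L_def)
  also have "fdet n (\<lambda>i j. \<Sum>m<n. L i m * B m j) = fdet n B'"
  proof (rule fdet_cong)
    fix i j assume ij: "i < n" "j < n"
    have "(\<Sum>m<n. L i m * B m j) = B i j + (\<Sum>m\<in>{..<n} - {i}. L i m * B m j)"
      using ij by (subst sum.remove[of _ i]) (auto simp: L_def)
    also have "(\<Sum>m\<in>{..<n} - {i}. L i m * B m j) = (if i = k then - S j else 0)"
    proof (cases "i = k")
      case True
      have "(\<Sum>m\<in>{..<n} - {i}. L i m * B m j) = (\<Sum>m\<in>{..<k}. - (c m * B m j))"
        using True ij by (intro sum.mono_neutral_cong_right) (auto simp: L_def)
      then show ?thesis using True by (simp add: S_def sum_negf)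
    qed (auto simp: L_def intro!: sum.neutral)
    finally show "(\<Sum>m<n. L i m * B m j) = B' i j" by (simp add: B'_def)
  qed
  finally have det: "fdet n B' = fdet n A" using B(1) by simp
  have SB': "cip n S (B' k) = 0"
  proof -
    have "cip n S (B' k) = (\<Sum>l<k. c l * cip n (B l) (B' k))"
      unfolding S_def[abs_def] by (rule cip_sum_left)
    also have "\<dots> = 0"
      using B'k cip_cnj[of n "B' k"] by (intro sum.neutral) (metis complex_cnj_zero lessThan_iff mult_zero_right)
    finally show ?thesis .
  qed
  have "cip n (B k) (B k) = cip n (\<lambda>m. B' k m + S m) (\<lambda>m. B' k m + S m)"
    by (simp add: B'_def)
  also have "\<dots> = cip n (B' k) (B' k) + cip n S S"
    using SB' cip_cnj[of n S "B' k"] by (simp add: cip_add_left cip_add_right)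
  finally have "(\<Sum>m<n. (cmod (B k m))\<^sup>2) = (\<Sum>m<n. (cmod (B' k m))\<^sup>2) + (\<Sum>m<n. (cmod (S m))\<^sup>2)"
    unfolding cip_self of_real_add[symmetric] of_real_eq_iff .
  moreover have "(\<Sum>m<n. (cmod (S m))\<^sup>2) \<ge> 0" by (intro sum_nonneg) auto
  ultimately have le: "(\<Sum>m<n. (cmod (B' k m))\<^sup>2) \<le> (\<Sum>m<n. (cmod (B k m))\<^sup>2)" by simp
  have "(\<Sum>m<n. (cmod (B' i m))\<^sup>2) \<le> (\<Sum>m<n. (cmod (A i m))\<^sup>2)" if "i < n" for i
    using B(2)[OF that] le by (cases "i = k") (auto simp: B'_def)
  moreover have "cip n (B' i) (B' j) = 0" if "i < Suc k" "j < i" for i j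
  proof (cases "i = k")
    case True
    then show ?thesis using that B'k[of j] by (simp add: B'_def[abs_def])
  next
    case False
    then show ?thesis using that B(3)[of i j] by (simp add: B'_def[abs_def])
  qed
  ultimately show ?case using det by (intro exI[of _ B']) auto
qed

lemma fdet_cnj: "fdet n (\<lambda>i j. cnj (A i j)) = cnj (fdet n A)"
  by (simp add: fdet_eq_sum)

text \<open>For orthogonal rows the Gram matrix is diagonal, so |det|^2 is the product of the
  squared row lengths; \<open>orthogonal_rows_exist\<close> reduces to this case.\<close>

lemma Hadamard_inequality:
  fixes A :: "nat \<Rightarrow> nat \<Rightarrow> complex"
  shows "(cmod (fdet n A))\<^sup>2 \<le> (\<Prod>i<n. \<Sum>m<n. (cmod (A i m))\<^sup>2)"
proof -
  obtain B where B: "fdet n B = fdet n A"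
    "\<And>i. i < n \<Longrightarrow> (\<Sum>m<n. (cmod (B i m))\<^sup>2) \<le> (\<Sum>m<n. (cmod (A i m))\<^sup>2)"
    "\<And>i j. i < n \<Longrightarrow> j < i \<Longrightarrow> cip n (B i) (B j) = 0"
    using orthogonal_rows_exist[of n n A] by auto
  have "complex_of_real ((cmod (fdet n A))\<^sup>2) = fdet n B * fdet n (\<lambda>i j. cnj (B j i))"
    unfolding complex_norm_square B(1)[symmetric]
    by (simp add: fdet_cnj fdet_transpose[of n B])
  also have "\<dots> = fdet n (\<lambda>i j. cip n (B i) (B j))"
    unfolding cip_def by (rule fdet_mult[symmetric])
  also have "\<dots> = (\<Prod>i<n. cip n (B i) (B i))"
  proof (rule fdet_lower_triangular)
    fix i j assume "i < j" "j < n"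
    then have "cip n (B j) (B i) = 0" using B(3) by auto
    then show "cip n (B i) (B j) = 0" using cip_cnj[of n "B j" "B i"] by simp
  qed
  also have "\<dots> = of_real (\<Prod>i<n. \<Sum>m<n. (cmod (B i m))\<^sup>2)"
    by (simp only: cip_self of_real_prod)
  finally have "(cmod (fdet n A))\<^sup>2 = (\<Prod>i<n. \<Sum>m<n. (cmod (B i m))\<^sup>2)"
    unfolding of_real_eq_iff .
  also have "\<dots> \<le> (\<Prod>i<n. \<Sum>m<n. (cmod (A i m))\<^sup>2)"
    using B(2) by (intro prod_mono) (auto intro: sum_nonneg)
  finally show ?thesis .
qed

section \<open>Integer polynomials on the complex torus\<close>

text \<open>An integer polynomial in the variables \<open>V\<close> is a list of pairs of a coefficient and an exponent
  function. Monomials may repeat, and exponents outside \<open>V\<close> are ignored.\<close>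

definition meval :: "'v set \<Rightarrow> (int \<times> ('v \<Rightarrow> nat)) list \<Rightarrow> ('v \<Rightarrow> 'a) \<Rightarrow> 'a::comm_ring_1" where
  "meval V xs x = (\<Sum>(c, e)\<leftarrow>xs. of_int c * (\<Prod>v\<in>V. x v ^ e v))"

definition mhom :: "'v set \<Rightarrow> nat \<Rightarrow> (int \<times> ('v \<Rightarrow> nat)) list \<Rightarrow> bool" where
  "mhom V h xs \<longleftrightarrow> (\<forall>(c, e)\<in>set xs. (\<Sum>v\<in>V. e v) = h)"

definition mmult :: "(int \<times> ('v \<Rightarrow> nat)) list \<Rightarrow> (int \<times> ('v \<Rightarrow> nat)) list \<Rightarrow> (int \<times> ('v \<Rightarrow> nat)) list" where
  "mmult xs ys = concat (map (\<lambda>(c, e). map (\<lambda>(c', e'). (c * c', \<lambda>v. e v + e' v)) ys) xs)"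

lemma meval_simps:
  "meval V [] x = 0"
  "meval V ((c, e) # xs) x = of_int c * (\<Prod>v\<in>V. x v ^ e v) + meval V xs x"
  "meval V (xs @ ys) x = meval V xs x + meval V ys x"
  by (simp_all add: meval_def)

lemma meval_mmult: "meval V (mmult xs ys) x = meval V xs x * meval V ys x"
proof (induction xs)
  case Nil
  then show ?case by (simp add: mmult_def meval_simps)
next
  case (Cons p xs)
  obtain c e where p: "p = (c, e)" by (cases p)
  have "meval V (map (\<lambda>(c', e'). (c * c', \<lambda>v. e v + e' v)) ys) x =
      of_int c * (\<Prod>v\<in>V. x v ^ e v) * meval V ys x"
    by (induction ys) (auto simp: meval_simps algebra_simps power_add prod.distrib)
  then show ?case using Cons by (simp add: p mmult_def meval_simps algebra_simps)
qed

lemma mhom_mmult: "mhom V h xs \<Longrightarrow> mhom V h' ys \<Longrightarrow> mhom V (h + h') (mmult xs ys)"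
  by (fastforce simp: mhom_def mmult_def sum.distrib)

text \<open>The point is that a single list represents the power over both rings, so a bound found
  over the complex numbers concerns the same integer coefficients.\<close>

lemma meval_power_exists:
  assumes "mhom V h xs"
  shows "\<exists>ys. mhom V (n * h) ys \<and> (\<forall>x::'v \<Rightarrow> 'a::comm_ring_1. meval V ys x = meval V xs x ^ n)
    \<and> (\<forall>x::'v \<Rightarrow> complex. meval V ys x = meval V xs x ^ n)"
proof (induction n)
  case 0
  show ?case
    by (rule exI[of _ "[(1, \<lambda>_. 0)]"]) (auto simp: mhom_def meval_simps)
next
  case (Suc n)
  then obtain ys where "mhom V (n * h) ys"
    "\<And>x::'v \<Rightarrow> 'a. meval V ys x = meval V xs x ^ n"
    "\<And>x::'v \<Rightarrow> complex. meval V ys x = meval V xs x ^ n" by auto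
  then show ?case using mhom_mmult[OF assms, of "n * h" ys]
    by (intro exI[of _ "mmult xs ys"]) (auto simp: meval_mmult)
qed

definition mcoeff :: "'v set \<Rightarrow> (int \<times> ('v \<Rightarrow> nat)) list \<Rightarrow> ('v \<Rightarrow> nat) \<Rightarrow> int" where
  "mcoeff V xs k = (\<Sum>(c, e)\<leftarrow>xs. if \<forall>v\<in>V. e v = k v then c else 0)"

text \<open>Repeated monomials are collected, so that the number of terms is governed by
  \<open>E\<close> and not by the length of the list. Extensional functions are unique
  representatives of the exponents on \<open>V\<close>.\<close>

lemma meval_eq_sum_mcoeff:
  assumes "finite V" "finite E" "\<And>c e. (c, e) \<in> set xs \<Longrightarrow> restrict e V \<in> E"
    and "E \<subseteq> extensional V"
  shows "meval V xs x = (\<Sum>k\<in>E. of_int (mcoeff V xs k) * (\<Prod>v\<in>V. x v ^ k v))"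
  using assms(3)
proof (induction xs)
  case Nil
  then show ?case by (simp add: meval_simps mcoeff_def)
next
  case (Cons p xs)
  obtain c e where p: "p = (c, e)" by (cases p)
  have e: "restrict e V \<in> E" by (rule Cons.prems[of c]) (simp add: p)
  have eq: "(\<forall>v\<in>V. e v = k v) \<longleftrightarrow> restrict e V = k" if "k \<in> E" for k
    using that assms(4) by (fastforce simp: fun_eq_iff extensional_def)
  have "(\<Sum>k\<in>E. of_int (mcoeff V (p # xs) k) * (\<Prod>v\<in>V. x v ^ k v)) =
     (\<Sum>k\<in>E. (if restrict e V = k then of_int c * (\<Prod>v\<in>V. x v ^ k v) else 0)) +
     (\<Sum>k\<in>E. of_int (mcoeff V xs k) * (\<Prod>v\<in>V. x v ^ k v))"
    unfolding sum.distrib[symmetric]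
    by (intro sum.cong refl) (auto simp: mcoeff_def p eq algebra_simps)
  also have "(\<Sum>k\<in>E. (if restrict e V = k then of_int c * (\<Prod>v\<in>V. x v ^ k v) else 0)) =
     of_int c * (\<Prod>v\<in>V. x v ^ e v)"
    using e assms(2) by (simp add: sum.delta')
  also have "(\<Sum>k\<in>E. of_int (mcoeff V xs k) * (\<Prod>v\<in>V. x v ^ k v)) = meval V xs x"
    by (intro Cons.IH[symmetric] Cons.prems) (rule list.set_intros(2))
  finally show ?case by (simp add: p meval_simps)
qed

lemma roots_of_unity_orthogonal:
  assumes "a < m" "b < m"
  shows "(\<Sum>u<m. cis (2 * pi * real u * (real a - real b) / real m)) = (if a = b then of_nat m else 0)"
proof (cases "a = b")
  case True
  then show ?thesis by simp
next
  case False
  have m: "m > 0" using assms by simp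
  define q where "q = cis (2 * pi * (real a - real b) / real m)"
  have "q ^ m = cis (2 * pi * (real a - real b))"
    using m by (simp add: q_def DeMoivre)
  also have "\<dots> = 1"
    using cis_multiple_2pi[of "real a - real b"] by simp
  finally have qm: "q ^ m = 1" .
  have "q \<noteq> 1"
  proof
    assume "q = 1"
    then have "cos (2 * pi * (real a - real b) / real m) = 1"
      unfolding q_def by (metis Re_complex_of_real cis.sel(1) of_real_1)
    then obtain i :: int where "2 * pi * (real a - real b) / real m = of_int i * 2 * pi"
      unfolding cos_one_2pi_int by auto
    then have "(2 * pi) * (real a - real b) = (2 * pi) * (of_int i * real m)"
      using m by (simp add: field_simps)
    then have "real a - real b = of_int i * real m"
      by (subst (asm) mult_cancel_left) simp
    then have "real_of_int (int a - int b) = real_of_int (i * int m)" by simp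
    then have eq: "int a - int b = i * int m" unfolding of_int_eq_iff .
    have "\<bar>int a - int b\<bar> < int m" using assms by auto
    then have "i = 0" unfolding eq abs_mult using m
      by (metis abs_of_nat mult_less_cancel_right2 zabs_less_one_iff of_nat_0_le_iff)
    then show False using eq False by simp
  qed
  have "(\<Sum>u<m. cis (2 * pi * real u * (real a - real b) / real m)) = (\<Sum>u<m. q ^ u)"
    by (simp add: q_def DeMoivre mult_ac)
  also have "\<dots> = 0" using geometric_sum[OF \<open>q \<noteq> 1\<close>, of m] qm by simp
  finally show ?thesis using False by simp
qed

text \<open>Discrete Fourier inversion: the mean over m-th roots of unity of the polynomial times
  the conjugate monomial is the coefficient, because exponents below m are distinct modulo m. A mean
  is at most the supremum on the torus.\<close>

lemma mcoeff_bound: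
  assumes V: "finite V" and E: "\<And>c e v. (c, e) \<in> set xs \<Longrightarrow> v \<in> V \<Longrightarrow> e v < m"
    and k: "\<And>v. v \<in> V \<Longrightarrow> k v < m"
    and B: "\<And>x. (\<And>v. v \<in> V \<Longrightarrow> cmod (x v) = 1) \<Longrightarrow> cmod (meval V xs x) \<le> B"
  shows "\<bar>real_of_int (mcoeff V xs k)\<bar> \<le> B"
proof (cases "m = 0")
  case True
  then have "V = {}" using k by auto
  moreover have "meval {} xs x = (of_int (mcoeff {} xs k) :: complex)" for x :: "'a \<Rightarrow> complex"
    by (induction xs) (auto simp: mcoeff_def meval_simps(1) meval_def)
  ultimately show ?thesis using B[of "\<lambda>_. 1"] by simp
next
  case False
  \<comment> \<open>\<open>T\<close> indexes the grid of points \<open>x u\<close>; the product of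
    the \<open>w u v\<close> over v is the conjugate of the monomial with exponents \<open>k\<close>
    at \<open>x u\<close>.\<close>
  define T where "T = PiE V (\<lambda>_. {..<m})"
  define x where "x u v = cis (2 * pi * real (u v) / real m)" for u :: "'a \<Rightarrow> nat" and v
  define w where "w u v = cis (- 2 * pi * real (u v) * real (k v) / real m)" for u :: "'a \<Rightarrow> nat" and v
  have T: "finite T" "card T = m ^ card V"
    unfolding T_def using V by (auto intro!: finite_PiE simp: card_PiE)
  have "(\<Sum>u\<in>T. (\<Prod>v\<in>V. w u v) * meval V xs (x u)) = of_nat (m ^ card V) * of_int (mcoeff V xs k)"
    using E
  proof (induction xs)
    case Nil
    then show ?case by (simp add: meval_simps mcoeff_def)
  next
    case (Cons p xs)
    obtain c e where p: "p = (c, e)" by (cases p)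
    have e: "e v < m" if "v \<in> V" for v using Cons.prems[of c e v] that p by auto
    have IH: "(\<Sum>u\<in>T. (\<Prod>v\<in>V. w u v) * meval V xs (x u)) = of_nat (m ^ card V) * of_int (mcoeff V xs k)"
      using Cons by auto
    have "(\<Sum>u\<in>T. (\<Prod>v\<in>V. w u v) * (\<Prod>v\<in>V. x u v ^ e v)) =
        (\<Sum>u\<in>T. \<Prod>v\<in>V. cis (2 * pi * real (u v) * (real (e v) - real (k v)) / real m))"
      unfolding prod.distrib[symmetric] w_def x_def
      by (intro sum.cong prod.cong refl)
         (simp add: DeMoivre cis_mult diff_divide_distrib algebra_simps)
    also have "\<dots> = (\<Prod>v\<in>V. \<Sum>u<m. cis (2 * pi * real u * (real (e v) - real (k v)) / real m))"
      unfolding T_def using V by (subst prod_sum_PiE) auto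
    also have "\<dots> = (\<Prod>v\<in>V. if e v = k v then of_nat m else 0)"
      using e k by (intro prod.cong refl roots_of_unity_orthogonal) auto
    also have "\<dots> = (if \<forall>v\<in>V. e v = k v then of_nat (m ^ card V) else 0)"
      using V by (auto simp: prod_zero_iff)
    finally have *: "(\<Sum>u\<in>T. (\<Prod>v\<in>V. w u v) * (\<Prod>v\<in>V. x u v ^ e v)) =
       (if \<forall>v\<in>V. e v = k v then of_nat (m ^ card V) else 0)" .
    have "(\<Sum>u\<in>T. (\<Prod>v\<in>V. w u v) * meval V (p # xs) (x u)) =
       of_int c * (\<Sum>u\<in>T. (\<Prod>v\<in>V. w u v) * (\<Prod>v\<in>V. x u v ^ e v)) +
       (\<Sum>u\<in>T. (\<Prod>v\<in>V. w u v) * meval V xs (x u))"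
      unfolding sum_distrib_left sum.distrib[symmetric]
      by (intro sum.cong refl) (simp add: p meval_simps algebra_simps)
    then show ?case unfolding * IH by (auto simp: p mcoeff_def algebra_simps)
  qed
  then have "real (m ^ card V) * \<bar>real_of_int (mcoeff V xs k)\<bar> =
      cmod (\<Sum>u\<in>T. (\<Prod>v\<in>V. w u v) * meval V xs (x u))"
    by (simp add: norm_mult norm_power)
  also have "\<dots> \<le> (\<Sum>u\<in>T. B)"
    by (intro sum_norm_le)
       (simp add: norm_mult w_def x_def B flip: prod_norm)
  also have "\<dots> = real (m ^ card V) * B" using T by simp
  finally show ?thesis using False by simp
qed

section \<open>Determinants over a field with an absolute value\<close>

text \<open>If a > b, then r = b / a < 1 and the assumption gives 1 \<le> (n h + 1)^q r^n, whose
  right side tends to 0.\<close>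

lemma le_of_power_le_poly_power:
  fixes a b :: real
  assumes b: "b \<ge> 0" and le: "\<And>n. a ^ n \<le> real (n * h + 1) ^ q * b ^ n"
  shows "a \<le> b"
proof (rule ccontr)
  assume "\<not> a \<le> b"
  then have ab: "a > b" by simp
  then have a: "a > 0" using b by simp
  define r where "r = b / a"
  have r: "0 \<le> r" "r < 1" using ab a b by (auto simp: r_def)
  have "(\<lambda>n. (real (n * h + 1)) ^ q * r ^ n) \<longlonglongrightarrow> 0"
  proof (cases "r = 0")
    case True
    show ?thesis
      by (rule tendsto_eventually, rule eventually_sequentiallyI[of 1]) (use True in auto)
  next
    case False
    \<comment> \<open>The (q+1)-th root shares out the decay: each of the q factors n h + 1 gets its
      own s^n, and one s^n remains.\<close>
    define s where "s = root (Suc q) r"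
    have s: "0 \<le> s" "s < 1" "s ^ Suc q = r"
      using r by (auto simp: s_def real_root_lt_1_iff simp del: power_Suc)
    have "(\<lambda>n. (real h * (of_nat n * s ^ n) + s ^ n) ^ q * s ^ n) \<longlonglongrightarrow> (real h * 0 + 0) ^ q * 0"
      using s by (intro tendsto_intros powser_times_n_limit_0 LIMSEQ_realpow_zero) auto
    moreover have "(real h * (of_nat n * s ^ n) + s ^ n) ^ q * s ^ n = (real (n * h + 1)) ^ q * r ^ n" for n
    proof -
      have "real h * (of_nat n * s ^ n) + s ^ n = real (n * h + 1) * s ^ n"
        by (simp add: algebra_simps)
      moreover have "r ^ n = (s ^ n) ^ q * s ^ n"
        unfolding s(3)[symmetric] by (simp add: power_mult_distrib mult_ac flip: power_mult)
      ultimately show ?thesis by (simp add: power_mult_distrib)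
    qed
    ultimately show ?thesis by simp
  qed
  moreover have "1 \<le> (real (n * h + 1)) ^ q * r ^ n" for n
    using le[of n] a by (simp add: r_def power_divide field_simps)
  ultimately have "(1::real) \<le> 0"
    by (intro LIMSEQ_le_const) auto
  then show False by simp
qed

locale abs_val =
  fixes av :: "'a::field \<Rightarrow> real"
  assumes absolute_value: "absolute_value av"
begin

lemma av_nonneg [simp]: "av x \<ge> 0"
  and av_eq_0 [simp]: "av x = 0 \<longleftrightarrow> x = 0"
  and av_mult: "av (x * y) = av x * av y"
  and av_triangle: "av (x + y) \<le> av x + av y"
  using absolute_value by (auto simp: absolute_value_def)

lemma av_zero [simp]: "av 0 = 0" by simp

lemma av_one [simp]: "av 1 = 1"
  using av_mult[of 1 1] av_eq_0[of 1] by simp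

lemma av_minus [simp]: "av (- x) = av x"
proof -
  have "av (-1) ^ 2 = 1" using av_mult[of "-1" "-1"] by (simp add: power2_eq_square)
  then have "av (-1) = 1" using av_nonneg[of "-1"] power2_eq_1_iff[of "av (-1)"] by auto
  then show ?thesis using av_mult[of "-1" x] by simp
qed

lemma av_sign [simp]: "av (of_int (sign p)) = 1"
  by (cases p rule: sign_cases) simp_all

lemma av_power: "av (x ^ n) = av x ^ n"
  by (induction n) (auto simp: av_mult)

lemma av_prod: "av (prod f A) = (\<Prod>x\<in>A. av (f x))"
  by (induction A rule: infinite_finite_induct) (auto simp: av_mult)

lemma av_pos: "x \<noteq> 0 \<Longrightarrow> av x > 0"
  using av_nonneg[of x] av_eq_0[of x] by linarith

lemma av_sum: "av (sum f A) \<le> (\<Sum>x\<in>A. av (f x))"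
proof (induction A rule: infinite_finite_induct)
  case (insert x A)
  then show ?case using av_triangle[of "f x" "sum f A"] by simp
qed auto

section \<open>Bounds transferred from the complex torus\<close>

lemma av_of_nat: "av (of_nat n) \<le> real n"
proof (induction n)
  case (Suc n)
  then show ?case using av_triangle[of 1 "of_nat n"] by simp
qed simp

lemma av_of_int: "av (of_int n) \<le> \<bar>real_of_int n\<bar>"
proof (cases "n \<ge> 0")
  case True
  then show ?thesis using av_of_nat[of "nat n"] by simp
next
  case False
  then show ?thesis using av_of_nat[of "nat (- n)"] av_minus[of "of_int n"] by simp
qed

text \<open>There are at most (h + 1)^|V| exponent vectors of total h. Each coefficient is an
  integer of size at most \<open>B\<close>, hence at most \<open>B\<close> under \<open>av\<close>,
  and each monomial is at most \<open>M ^ h\<close>.\<close>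

lemma av_meval_weak:
  assumes V: "finite V" and hom: "mhom V h xs" and "M \<ge> 0"
    and x: "\<And>v. v \<in> V \<Longrightarrow> av (x v) \<le> M"
    and B: "\<And>y. (\<And>v. v \<in> V \<Longrightarrow> cmod (y v) = 1) \<Longrightarrow> cmod (meval V xs y) \<le> B"
  shows "av (meval V xs x) \<le> real (h + 1) ^ card V * (B * M ^ h)"
proof -
  define E where "E = {k \<in> PiE V (\<lambda>_. {..h}). (\<Sum>v\<in>V. k v) = h}"
  have le: "e v \<le> h" if "(c, e) \<in> set xs" "v \<in> V" for c e v
  proof -
    have "(\<Sum>v\<in>V. e v) = h" using hom that by (auto simp: mhom_def)
    then show ?thesis using member_le_sum[of v V e] V that by auto
  qed
  have "finite (PiE V (\<lambda>_. {..h}))" using V by (auto intro!: finite_PiE)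
  then have E: "finite E" "card E \<le> (h + 1) ^ card V"
    using card_mono[of "PiE V (\<lambda>_. {..h})" E] V by (auto simp: E_def card_PiE)
  have "B \<ge> 0" using order_trans[OF norm_ge_zero B[of "\<lambda>_. 1"]] by simp
  have "meval V xs x = (\<Sum>k\<in>E. of_int (mcoeff V xs k) * (\<Prod>v\<in>V. x v ^ k v))"
  proof (rule meval_eq_sum_mcoeff)
    fix c e assume ce: "(c, e) \<in> set xs"
    then have "(\<Sum>v\<in>V. e v) = h" using hom by (auto simp: mhom_def)
    then show "restrict e V \<in> E" using le[OF ce] by (auto simp: E_def)
  qed (use V E in \<open>auto simp: E_def PiE_def\<close>)
  also have "av \<dots> \<le> (\<Sum>k\<in>E. av (of_int (mcoeff V xs k) * (\<Prod>v\<in>V. x v ^ k v)))"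
    by (rule av_sum)
  also have "\<dots> \<le> (\<Sum>k\<in>E. B * M ^ h)"
  proof (rule sum_mono)
    fix k assume k: "k \<in> E"
    have "av (of_int (mcoeff V xs k)) \<le> \<bar>real_of_int (mcoeff V xs k)\<bar>" by (rule av_of_int)
    also have "\<dots> \<le> B"
    proof (rule mcoeff_bound[OF V, of xs "h + 1"])
      show "e v < h + 1" if "(c, e) \<in> set xs" "v \<in> V" for c e v
        using le[OF that] by simp
      show "k v < h + 1" if "v \<in> V" for v
        using k that by (auto simp: E_def PiE_def Pi_def le_imp_less_Suc)
    qed (use B in auto)
    finally have 1: "av (of_int (mcoeff V xs k)) \<le> B" .
    have "av (\<Prod>v\<in>V. x v ^ k v) \<le> (\<Prod>v\<in>V. M ^ k v)"
      unfolding av_prod av_power using x by (intro prod_mono) (auto intro: power_mono)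
    also have "\<dots> = M ^ h" using k by (simp add: E_def flip: power_sum)
    finally show "av (of_int (mcoeff V xs k) * (\<Prod>v\<in>V. x v ^ k v)) \<le> B * M ^ h"
      unfolding av_mult using 1 \<open>B \<ge> 0\<close> by (intro mult_mono) auto
  qed
  also have "\<dots> = real (card E) * (B * M ^ h)" by simp
  also have "\<dots> \<le> real (h + 1) ^ card V * (B * M ^ h)"
    using of_nat_mono[OF E(2), where 'a = real] \<open>B \<ge> 0\<close> \<open>M \<ge> 0\<close>
    by (intro mult_right_mono) (simp_all only: of_nat_power zero_le_mult_iff zero_le_power simp_thms)
  finally show ?thesis .
qed

text \<open>Applying the weak bound to powers of the polynomial removes the polynomial factor. This
  transfers an inequality over the complex numbers to an arbitrary absolute value without
  Ostrowski's theorem.\<close>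

lemma av_meval_bound:
  fixes xs :: "(int \<times> ('v \<Rightarrow> nat)) list"
  assumes V: "finite V" and hom: "mhom V h xs" and M: "M \<ge> 0"
    and x: "\<And>v. v \<in> V \<Longrightarrow> av (x v) \<le> M"
    and B: "\<And>y. (\<And>v. v \<in> V \<Longrightarrow> cmod (y v) = 1) \<Longrightarrow> cmod (meval V xs y) \<le> B"
  shows "av (meval V xs x) \<le> B * M ^ h"
proof (rule le_of_power_le_poly_power)
  have "B \<ge> 0" using order_trans[OF norm_ge_zero B[of "\<lambda>_. 1"]] by simp
  then show "B * M ^ h \<ge> 0" using M by simp
  fix n
  obtain ys where ys: "mhom V (n * h) ys"
    "\<And>x::'v \<Rightarrow> 'a. meval V ys x = meval V xs x ^ n"
    "\<And>x::'v \<Rightarrow> complex. meval V ys x = meval V xs x ^ n"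
    using meval_power_exists[OF hom, of n] by blast
  have "av (meval V ys x) \<le> real (n * h + 1) ^ card V * (B ^ n * M ^ (n * h))"
  proof (rule av_meval_weak[OF V ys(1) M x])
    show "cmod (meval V ys y) \<le> B ^ n" if "\<And>v. v \<in> V \<Longrightarrow> cmod (y v) = 1" for y
      unfolding ys(3) norm_power using B[OF that] by (intro power_mono) auto
  qed
  then show "av (meval V xs x) ^ n \<le> real (n * h + 1) ^ card V * (B * M ^ h) ^ n"
    by (simp add: ys(2) av_power power_mult_distrib mult.commute[of n] flip: power_mult)
qed

text \<open>The determinant is an integer form of degree n in its entries. On the torus every row
  has Euclidean length sqrt n, so Hadamard gives the supremum bound that
  \<open>av_meval_bound\<close> carries over.\<close>

lemma av_fdet_le:
  assumes M: "M \<ge> 0" and A: "\<And>i j. i < n \<Longrightarrow> j < n \<Longrightarrow> av (A i j) \<le> M"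
  shows "av (fdet n A) \<le> sqrt (real n ^ n) * M ^ n"
proof -
  define V where "V = {0..<n} \<times> {0..<n}"
  have "finite {p. p permutes {0..<n}}" by (simp add: finite_permutations)
  then obtain ps where ps: "set ps = {p. p permutes {0..<n}}" "distinct ps"
    using finite_distinct_list by blast
  \<comment> \<open>One monomial per permutation, with the permutation matrix as exponents; the same
    list yields the determinant over every commutative ring.\<close>
  define xs where "xs = map (\<lambda>p. (sign p, \<lambda>(i, j). if j = p i then 1 else 0 :: nat)) ps"
  have row: "(\<Prod>j = 0..<n. f j ^ (if j = p i then 1 else 0)) = f (p i)"
    if "p permutes {0..<n}" "i < n" for p i and f :: "nat \<Rightarrow> 'b::comm_ring_1"
  proof -
    have "p i \<in> {0..<n}" using permutes_in_image[OF that(1), of i] that(2) by simp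
    then show ?thesis by (subst prod.remove[of _ "p i"]) (auto intro!: prod.neutral)
  qed
  have eval: "meval V xs (\<lambda>(i, j). C i j) = fdet n C" for C :: "nat \<Rightarrow> nat \<Rightarrow> 'b::comm_ring_1"
  proof -
    have "meval V xs (\<lambda>(i, j). C i j) = (\<Sum>p\<leftarrow>ps. of_int (sign p) *
        (\<Prod>i = 0..<n. \<Prod>j = 0..<n. C i j ^ (if j = p i then 1 else 0)))"
      by (simp add: meval_def xs_def V_def prod.cartesian_product o_def case_prod_unfold)
    also have "\<dots> = (\<Sum>p | p permutes {0..<n}. of_int (sign p) *
        (\<Prod>i = 0..<n. \<Prod>j = 0..<n. C i j ^ (if j = p i then 1 else 0)))"
      using ps by (simp add: sum_list_distinct_conv_sum_set)
    also have "\<dots> = fdet n C"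
      unfolding fdet_eq_sum
      by (intro sum.cong refl arg_cong2[where f = "(*)"] prod.cong) (auto intro: row)
    finally show ?thesis .
  qed
  have "av (meval V xs (\<lambda>(i, j). A i j)) \<le> sqrt (real n ^ n) * M ^ n"
  proof (rule av_meval_bound[OF _ _ M])
    show "finite V" by (simp add: V_def)
    show "mhom V n xs"
    proof -
      have "(\<Sum>v\<in>V. case v of (i, j) \<Rightarrow> if j = p i then 1 else 0) = n"
        if p: "p permutes {0..<n}" for p
      proof -
        have "(\<Sum>j = 0..<n. if j = p i then 1 else 0) = (1::nat)" if "i < n" for i
          using permutes_in_image[OF p, of i] that by (simp add: sum.delta)
        then have "(\<Sum>i = 0..<n. \<Sum>j = 0..<n. if j = p i then 1 else 0) = (\<Sum>i = 0..<n. 1::nat)"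
          by (intro sum.cong) auto
        then show ?thesis unfolding V_def
          by (simp only: sum.cartesian_product) simp
      qed
      then show ?thesis using ps by (auto simp: mhom_def xs_def)
    qed
    show "av (case v of (i, j) \<Rightarrow> A i j) \<le> M" if "v \<in> V" for v
      using that A by (auto simp: V_def)
    fix y :: "nat \<times> nat \<Rightarrow> complex" assume y: "\<And>v. v \<in> V \<Longrightarrow> cmod (y v) = 1"
    define C where "C i j = y (i, j)" for i j
    have "(cmod (fdet n C))\<^sup>2 \<le> (\<Prod>i<n. \<Sum>m<n. (cmod (C i m))\<^sup>2)"
      by (rule Hadamard_inequality)
    also have "\<dots> = real n ^ n"
      using y by (simp add: C_def V_def)
    finally have "cmod (fdet n C) \<le> sqrt (real n ^ n)"
      by (rule real_le_rsqrt)
    then show "cmod (meval V xs y) \<le> sqrt (real n ^ n)"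
      using eval[of C] by (simp add: C_def)
  qed
  then show ?thesis by (simp add: eval)
qed

section \<open>The non-archimedean case and the logarithmic form\<close>

lemma av_sum_nonarch:
  assumes "nonarchimedean av" "C \<ge> 0" "\<And>x. x \<in> A \<Longrightarrow> av (f x) \<le> C"
  shows "av (sum f A) \<le> C"
  using assms(3)
proof (induction A rule: infinite_finite_induct)
  case (insert x A)
  have "av (sum f (insert x A)) \<le> max (av (f x)) (av (sum f A))"
    using insert(1,2) assms(1) by (simp add: nonarchimedean_def)
  also have "\<dots> \<le> C" using insert by simp
  finally show ?case .
qed (use assms in auto)

lemma av_fdet_le_nonarch:
  assumes na: "nonarchimedean av" and M: "M \<ge> 0"
    and A: "\<And>i j. i < n \<Longrightarrow> j < n \<Longrightarrow> av (A i j) \<le> M"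
  shows "av (fdet n A) \<le> M ^ n"
  unfolding fdet_eq_sum
proof (rule av_sum_nonarch[OF na])
  fix p assume "p \<in> {p. p permutes {0..<n}}"
  then have "p i < n" if "i < n" for i
    using permutes_in_image[of p "{0..<n}" i] that by simp
  then have "(\<Prod>i = 0..<n. av (A i (p i))) \<le> (\<Prod>i = 0..<n. M)"
    using A by (intro prod_mono) auto
  then show "av (of_int (sign p) * (\<Prod>i = 0..<n. A i (p i))) \<le> M ^ n"
    by (simp add: av_mult av_prod)
qed (use M in auto)

lemma ln_av_fdet_le:
  assumes M: "M > 0" and A: "\<And>i j. i < n \<Longrightarrow> j < n \<Longrightarrow> av (A i j) \<le> M"
    and n: "n > 0" and nz: "fdet n A \<noteq> 0"
  shows "2 * ln (av (fdet n A)) \<le> eps av * real n * ln (real n) + 2 * real n * ln M"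
proof (cases "nonarchimedean av")
  case True
  have "ln (av (fdet n A)) \<le> ln (M ^ n)"
    using av_fdet_le_nonarch[OF True, of M n A] A M nz by (subst ln_le_cancel_iff) (auto intro: av_pos)
  then show ?thesis using True M by (simp add: eps_def ln_realpow)
next
  case False
  have "ln (av (fdet n A)) \<le> ln (sqrt (real n ^ n) * M ^ n)"
    using av_fdet_le[of M n A] A M n nz by (subst ln_le_cancel_iff) (auto intro: av_pos)
  also have "\<dots> = real n * ln (real n) / 2 + real n * ln M"
    using M n by (simp add: ln_mult ln_sqrt ln_realpow)
  finally show ?thesis using False by (simp add: eps_def)
qed

end

section \<open>Products of powers of two polynomials\<close>

text \<open>The index r = i + d a with i < d and a < n stands for T^i f^a g^(n-1-a), the
  dehomogenised x^i y^(d-1-i) F1^a F2^(n-1-a).\<close>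

definition prod_poly :: "nat \<Rightarrow> 'a::field poly \<Rightarrow> 'a poly \<Rightarrow> nat \<Rightarrow> nat \<Rightarrow> 'a poly" where
  "prod_poly d f g n r = monom 1 (r mod d) * f ^ (r div d) * g ^ (n - 1 - r div d)"

text \<open>Multiplication by \<open>h\<close> on \<open>K[T]/(f)\<close> in the basis \<open>1, T, T\<^sup>2, \<dots>\<close>\<close>

definition mod_mat :: "'a::field poly \<Rightarrow> 'a poly \<Rightarrow> nat \<Rightarrow> nat \<Rightarrow> 'a" where
  "mod_mat f h i j = coeff ((monom 1 i * h) mod f) j"

lemma poly_eq_sum_monom:
  fixes p :: "'a::field poly"
  assumes "degree p < n \<or> p = 0"
  shows "p = (\<Sum>l<n. smult (coeff p l) (monom 1 l))"
  using assms by (intro poly_eqI) (auto simp: coeff_sum coeff_eq_0 sum.delta if_distrib[of "(*) _"] cong: if_cong)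

lemma sum_lessThan_add:
  fixes a b :: nat
  shows "(\<Sum>k<a + b. f k) = (\<Sum>k<a. f k) + (\<Sum>k<b. f (a + k))"
  by (induction b) (auto simp: add.assoc)

lemma mod_sum_poly:
  fixes f :: "'a::field poly"
  shows "(\<Sum>x\<in>A. p x) mod f = (\<Sum>x\<in>A. p x mod f)"
  by (induction A rule: infinite_finite_induct) (auto simp: poly_mod_add_left)

text \<open>Expanding the remainder of T^i h in powers of T before multiplying by h' turns
  composition of multiplications into a matrix product.\<close>

lemma mod_mat_mult:
  assumes f: "degree f = d" "d > 0"
  shows "mod_mat f (h * h') i j = (\<Sum>k<d. mod_mat f h i k * mod_mat f h' k j)"
proof -
  define q where "q = (monom 1 i * h) mod f"
  have "f \<noteq> 0" using f by auto
  then have "degree q < d \<or> q = 0" using degree_mod_less[of f "monom 1 i * h"] f by (auto simp: q_def)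
  then have q: "q = (\<Sum>k<d. smult (coeff q k) (monom 1 k))" by (rule poly_eq_sum_monom)
  have "(monom 1 i * (h * h')) mod f = (q * h') mod f"
    by (simp add: q_def mod_mult_left_eq mult.assoc)
  also have "q * h' = (\<Sum>k<d. smult (coeff q k) (monom 1 k * h'))"
    by (subst q) (simp add: sum_distrib_right)
  also have "\<dots> mod f = (\<Sum>k<d. smult (coeff q k) ((monom 1 k * h') mod f))"
    by (simp add: mod_sum_poly mod_smult_left)
  finally show ?thesis by (simp add: mod_mat_def q_def coeff_sum)
qed

lemma fdet_mod_mat_one:
  assumes f: "degree f = d" "d > 0"
  shows "fdet d (mod_mat f 1) = 1"
proof -
  have "fdet d (mod_mat f 1) = fdet d (\<lambda>i j. if i = j then 1 else 0)"
  proof (rule fdet_cong)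
    fix i j assume "i < d"
    then have "monom 1 i mod f = monom (1::'a) i"
      using f by (intro mod_poly_less) (simp add: degree_monom_eq)
    then show "mod_mat f 1 i j = (if i = j then 1 else 0)" by (simp add: mod_mat_def)
  qed
  then show ?thesis by (simp add: fdet_one)
qed

lemma fdet_mod_mat_mult:
  assumes f: "degree f = d" "d > 0"
  shows "fdet d (mod_mat f (h * h')) = fdet d (mod_mat f h) * fdet d (mod_mat f h')"
  unfolding fdet_mult[symmetric] by (intro fdet_cong mod_mat_mult f)

lemma fdet_mod_mat_power:
  assumes f: "degree f = d" "d > 0"
  shows "fdet d (mod_mat f (h ^ n)) = fdet d (mod_mat f h) ^ n"
  by (induction n) (simp_all add: fdet_mod_mat_one[OF f] fdet_mod_mat_mult[OF f])

lemma degree_div_add_le: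
  fixes p f :: "'a::field poly"
  assumes "degree f > 0" "p div f \<noteq> 0"
  shows "degree (p div f) + degree f \<le> degree p"
proof -
  have "f \<noteq> 0" using assms by auto
  then have "degree (p div f) + degree f = degree (p - p mod f)"
    using assms degree_mult_eq[of "p div f" f] by (simp add: minus_mod_eq_div_mult)
  also have "\<dots> \<le> max (degree p) (degree (p mod f))" by (rule degree_diff_le_max)
  finally show ?thesis using degree_mod_less'[of f p] assms \<open>f \<noteq> 0\<close> by (cases "p mod f = 0") auto
qed

lemma degree_power_le_mult: "degree p \<le> d \<Longrightarrow> degree (p ^ n) \<le> d * n"
  by (rule order_trans[OF degree_power_le]) simp

lemma degree_prod_poly:
  assumes "degree f \<le> d" "degree g \<le> d" "d > 0" "r < n * d"
  shows "degree (prod_poly d f g n r) < n * d"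
proof -
  have a: "r div d < n" using assms by (simp add: less_mult_imp_div_less)
  have "degree (prod_poly d f g n r) \<le> degree (monom (1::'a) (r mod d)) + degree (f ^ (r div d)) + degree (g ^ (n - 1 - r div d))"
    unfolding prod_poly_def
    by (meson add_le_mono1 degree_mult_le order_trans)
  also have "\<dots> \<le> (d - 1) + d * (r div d) + d * (n - 1 - r div d)"
    using assms mod_less_divisor[OF assms(3), of r]
    by (intro add_mono degree_power_le_mult) (auto simp: degree_monom_eq)
  also have "\<dots> = (d - 1) + d * (n - 1)"
    using a by (simp add: add.assoc flip: add_mult_distrib2)
  also have "\<dots> < n * d" using assms(3) a by (cases n) (auto simp: mult.commute)
  finally show ?thesis .
qed

text \<open>Dividing the rows \<open>T\<^sup>i g\<^sup>n\<close> by \<open>f\<close> factors the coefficient matrix of the products into a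
  block triangular and a triangular matrix.\<close>

lemma fdet_prod_poly_Suc:
  assumes f: "degree f = d" and g: "degree g \<le> d" and d: "d > 0"
  shows "fdet (d + n * d) (\<lambda>r j. coeff (prod_poly d f g (Suc n) r) j) =
    fdet d (mod_mat f g) ^ n * lead_coeff f ^ (n * d) * fdet (n * d) (\<lambda>r j. coeff (prod_poly d f g n r) j)"
proof -
  have f0: "f \<noteq> 0" using f d by auto
  \<comment> \<open>Rows with r < d carry no factor f and are divided with remainder; the others are
    f times the family for n. The rows of \<open>E\<close> are 1, ..., T^(d-1), f, f T, ..., so its
    diagonal has d ones and then only the leading coefficient of f.\<close>
  define L where "L r k = (if r < d
      then if k < d then mod_mat f (g ^ n) r k else coeff ((monom 1 r * g ^ n) div f) (k - d)
      else if k < d then 0 else coeff (prod_poly d f g n (r - d)) (k - d))" for r k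
  define E where "E k j = (if k < d then coeff (monom 1 k) j else coeff (f * monom 1 (k - d)) j)" for k j
  have "fdet (d + n * d) (\<lambda>r j. coeff (prod_poly d f g (Suc n) r) j) =
      fdet (d + n * d) (\<lambda>r j. \<Sum>k<d + n * d. L r k * E k j)"
  proof (rule fdet_cong)
    fix r j assume r: "r < d + n * d"
    have split: "(\<Sum>k<d + n * d. L r k * E k j) = (\<Sum>k<d. L r k * E k j) + (\<Sum>k<n * d. L r (d + k) * E (d + k) j)"
      by (rule sum_lessThan_add)
    show "coeff (prod_poly d f g (Suc n) r) j = (\<Sum>k<d + n * d. L r k * E k j)"
    proof (cases "r < d")
      case True
      define p where "p = monom 1 r * g ^ n"
      have "degree p \<le> r + d * n" unfolding p_def
        by (rule order_trans[OF degree_mult_le]) (simp add: degree_monom_eq degree_power_le_mult g)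
      then have "degree (p div f) < n * d \<or> p div f = 0"
        using degree_div_add_le[of f p] f d True by (fastforce simp: algebra_simps)
      then have div: "p div f = (\<Sum>k<n * d. smult (coeff (p div f) k) (monom 1 k))"
        by (rule poly_eq_sum_monom)
      have "degree (p mod f) < d \<or> p mod f = 0" using degree_mod_less[of f p] f f0 by auto
      then have md: "p mod f = (\<Sum>k<d. smult (coeff (p mod f) k) (monom 1 k))"
        by (rule poly_eq_sum_monom)
      have "p = p mod f + f * (p div f)" by simp
      also have "coeff \<dots> j = (\<Sum>k<d. L r k * E k j) + (\<Sum>k<n * d. L r (d + k) * E (d + k) j)"
        unfolding coeff_add
        by (subst md, subst div)
           (simp add: L_def E_def True mod_mat_def sum_distrib_left coeff_sum flip: p_def)
      finally show ?thesis unfolding split using True by (simp add: prod_poly_def p_def)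
    next
      case False
      define s where "s = r - d"
      have rs: "r = d + s" "s < n * d" using False r by (auto simp: s_def)
      define p where "p = prod_poly d f g n s"
      have "degree p < n * d" unfolding p_def using f g d rs by (intro degree_prod_poly) auto
      then have p: "p = (\<Sum>k<n * d. smult (coeff p k) (monom 1 k))"
        by (intro poly_eq_sum_monom) auto
      have "prod_poly d f g (Suc n) r = f * p"
        using d by (simp add: rs prod_poly_def p_def algebra_simps)
      also have "coeff \<dots> j = (\<Sum>k<d. L r k * E k j) + (\<Sum>k<n * d. L r (d + k) * E (d + k) j)"
        by (subst p) (simp add: L_def E_def rs sum_distrib_left coeff_sum flip: p_def)
      finally show ?thesis unfolding split .
    qed
  qed
  also have "\<dots> = fdet (d + n * d) L * fdet (d + n * d) E" by (rule fdet_mult)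
  also have "fdet (d + n * d) L = fdet d L * fdet (n * d) (\<lambda>i j. L (d + i) (d + j))"
    by (rule fdet_block_upper) (simp add: L_def)
  also have "fdet d L = fdet d (mod_mat f (g ^ n))" by (rule fdet_cong) (simp add: L_def)
  also have "\<dots> = fdet d (mod_mat f g) ^ n" by (rule fdet_mod_mat_power[OF f d])
  also have "fdet (d + n * d) E = fdet d E * fdet (n * d) (\<lambda>i j. E (d + i) (d + j))"
    by (rule fdet_block_lower) (simp add: E_def)
  also have "fdet d E = fdet d (\<lambda>i j. if i = j then 1 else 0)"
    by (rule fdet_cong) (simp add: E_def)
  also have "\<dots> = 1" by (rule fdet_one)
  also have "fdet (n * d) (\<lambda>i j. E (d + i) (d + j)) = (\<Prod>i<n * d. E (d + i) (d + i))"
    by (rule fdet_lower_triangular)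
       (auto simp: E_def f mult.commute[of f] coeff_monom_mult coeff_eq_0)
  also have "\<dots> = lead_coeff f ^ (n * d)"
    by (simp add: E_def f mult.commute[of f] coeff_monom_mult)
  also have "fdet (n * d) (\<lambda>i j. L (d + i) (d + j)) = fdet (n * d) (\<lambda>r j. coeff (prod_poly d f g n r) j)"
    by (rule fdet_cong) (simp add: L_def)
  finally show ?thesis by (simp add: mult_ac)
qed

text \<open>The exponents 0, 1, ..., n - 1 from the recursion add up to n(n-1)/2. For n = 2 this is
  1, so the base on the right is itself the determinant for n = 2, the resultant up to sign.\<close>

lemma fdet_prod_poly:
  assumes f: "degree f = d" and g: "degree g \<le> d" and d: "d > 0"
  shows "fdet (n * d) (\<lambda>r j. coeff (prod_poly d f g n r) j) =
    (fdet d (mod_mat f g) * lead_coeff f ^ d) ^ (n * (n - 1) div 2)"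
proof (induction n)
  case 0
  show ?case by (simp add: fdet_def)
next
  case (Suc n)
  have "even (n * (n - 1))" by (cases n) auto
  then have "Suc n * (Suc n - 1) div 2 = n + n * (n - 1) div 2"
    by (cases n) (auto simp: algebra_simps)
  then show ?case using fdet_prod_poly_Suc[OF assms, of n] Suc
    by (simp add: power_add power_mult_distrib mult_ac flip: power_mult)
qed

section \<open>The resultant\<close>

context abs_val
begin

lemma av_fdet_permute_rows:
  assumes "p permutes {0..<n}"
  shows "av (fdet n (\<lambda>i j. A (p i) j)) = av (fdet n A)"
  using fdet_permute_rows[OF assms, of A] by (simp add: av_mult)

lemma av_fdet_permute_cols:
  assumes "p permutes {0..<n}"
  shows "av (fdet n (\<lambda>i j. A i (p j))) = av (fdet n A)"
  using fdet_permute_cols[OF assms, of A] by (simp add: av_mult)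

end

lemma permutes_extend:
  fixes n :: nat
  assumes "\<And>i. i < n \<Longrightarrow> q i < n" "inj_on q {0..<n}"
  shows "(\<lambda>i. if i < n then q i else i) permutes {0..<n}"
proof (rule bij_imp_permutes)
  have "inj_on (\<lambda>i. if i < n then q i else i) {0..<n}"
    using assms(2) by (auto simp: inj_on_def)
  moreover have "(\<lambda>i. if i < n then q i else i) ` {0..<n} \<subseteq> {0..<n}" using assms(1) by auto
  ultimately show "bij_betw (\<lambda>i. if i < n then q i else i) {0..<n} {0..<n}"
    unfolding bij_betw_def by (intro conjI endo_inj_surj) simp_all
qed auto

context abs_val
begin

lemma av_fdet_reindex_rows:
  assumes "\<And>i. i < n \<Longrightarrow> q i < n" "inj_on q {0..<n}"
  shows "av (fdet n (\<lambda>i j. A (q i) j)) = av (fdet n A)"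
proof -
  have "fdet n (\<lambda>i j. A (q i) j) = fdet n (\<lambda>i j. A (if i < n then q i else i) j)"
    by (rule fdet_cong) simp
  then show ?thesis
    using av_fdet_permute_rows[OF permutes_extend[OF assms], of A] by simp
qed

lemma av_fdet_reindex_cols:
  assumes "\<And>i. i < n \<Longrightarrow> q i < n" "inj_on q {0..<n}"
  shows "av (fdet n (\<lambda>i j. A i (q j))) = av (fdet n A)"
proof -
  have "fdet n (\<lambda>i j. A i (q j)) = fdet n (\<lambda>i j. A i (if j < n then q j else j))"
    by (rule fdet_cong) simp
  then show ?thesis
    using av_fdet_permute_cols[OF permutes_extend[OF assms], of A] by simp
qed

text \<open>Exchanging f and g reverses the order of the blocks of d rows. This lets either
  polynomial be the divisor, which has to attain degree d.\<close>

lemma av_fdet_prod_poly_swap: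
  assumes d: "d > 0"
  shows "av (fdet (n * d) (\<lambda>r j. coeff (prod_poly d g f n r) j)) =
    av (fdet (n * d) (\<lambda>r j. coeff (prod_poly d f g n r) j))"
proof -
  define q where "q r = r mod d + d * (n - 1 - r div d)" for r
  have q: "q r < n * d" "q r mod d = r mod d" "q r div d = n - 1 - r div d" if "r < n * d" for r
  proof -
    have "n > 0" using that by (cases n) auto
    show "q r mod d = r mod d" "q r div d = n - 1 - r div d"
      using d by (auto simp: q_def)
    have "d * (n - 1 - r div d) \<le> d * (n - 1)" by (intro mult_le_mono2 diff_le_self)
    then have "q r < d + d * (n - 1)"
      using mod_less_divisor[OF d, of r] by (simp only: q_def)
    then show "q r < n * d" using \<open>n > 0\<close> by (cases n) (auto simp: mult.commute)
  qed
  have div: "r div d < n" if "r < n * d" for r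
    using that by (rule less_mult_imp_div_less)
  have inj: "inj_on q {0..<n * d}"
  proof (rule inj_onI)
    fix r s assume rs: "r \<in> {0..<n * d}" "s \<in> {0..<n * d}" "q r = q s"
    then have "r mod d = s mod d" "n - 1 - r div d = n - 1 - s div d"
      using q(2,3)[of r] q(2,3)[of s] by auto
    moreover have "r div d < n" "s div d < n" using rs div by auto
    ultimately have "r div d = s div d" "r mod d = s mod d" by linarith+
    then show "r = s" by (metis div_mult_mod_eq)
  qed
  have "av (fdet (n * d) (\<lambda>r j. coeff (prod_poly d g f n r) j)) =
    av (fdet (n * d) (\<lambda>r j. coeff (prod_poly d f g n (q r)) j))"
  proof (intro arg_cong[where f = av] fdet_cong)
    fix r j assume "r < n * d"
    then have "prod_poly d g f n r = prod_poly d f g n (q r)"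
      using q[of r] div[of r] by (simp add: prod_poly_def mult_ac)
    then show "coeff (prod_poly d g f n r) j = coeff (prod_poly d f g n (q r)) j" by simp
  qed
  also have "\<dots> = av (fdet (n * d) (\<lambda>r j. coeff (prod_poly d f g n r) j))"
    using av_fdet_reindex_rows[OF q(1) inj, of "\<lambda>r j. coeff (prod_poly d f g n r) j"] by simp
  finally show ?thesis .
qed

text \<open>The rows \<open>T\<^sup>i g\<close>, \<open>T\<^sup>i f\<close> are those of the Sylvester matrix, with rows and columns
  reversed.\<close>

lemma av_resultant_sub:
  assumes f: "degree f \<le> d" and g: "degree g \<le> d" and d: "d > 0"
  shows "av (resultant_sub d d f g) = av (fdet (2 * d) (\<lambda>r j. coeff (prod_poly d f g 2 r) j))"
proof -
  define q where "q i = 2 * d - 1 - i" for i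
  have q: "q i < 2 * d" for i using d by (simp add: q_def)
  have inj: "inj_on q {0..<2 * d}" by (auto simp: inj_on_def q_def)
  have "resultant_sub d d f g = fdet (2 * d) (\<lambda>i j. coeff (prod_poly d f g 2 (q i)) (q j))"
    unfolding resultant_sub_def fdet_def
  proof (intro arg_cong[where f = det] eq_matI)
    fix i j
    assume "i < dim_row (mat (2 * d) (2 * d) (\<lambda>(i, j). coeff (prod_poly d f g 2 (q i)) (q j)))"
      "j < dim_col (mat (2 * d) (2 * d) (\<lambda>(i, j). coeff (prod_poly d f g 2 (q i)) (q j)))"
    then have ij: "i < 2 * d" "j < 2 * d" by auto
    have "coeff (prod_poly d f g 2 (q i)) (q j) =
      (if i < d then if i \<le> j \<and> j - i \<le> d then coeff f (d + i - j) else 0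
       else if i - d \<le> j \<and> j \<le> i then coeff g (i - j) else 0)"
    proof (cases "i < d")
      case True
      define s where "s = d - 1 - i"
      have "s < d" using d by (simp add: s_def)
      have "q i = s + d" using True by (auto simp: q_def s_def)
      then have "prod_poly d f g 2 (q i) = monom 1 s * f"
        using \<open>s < d\<close> by (simp add: prod_poly_def)
      then have "coeff (prod_poly d f g 2 (q i)) (q j) = (if s \<le> q j then coeff f (q j - s) else 0)"
        by (simp add: coeff_monom_mult)
      also have "\<dots> = (if i \<le> j \<and> j - i \<le> d then coeff f (d + i - j) else 0)"
      proof -
        have "coeff f (d + i - j) = 0" if "j < i" using that f by (intro coeff_eq_0) auto
        moreover have "s \<le> q j \<longleftrightarrow> j - i \<le> d" "q j - s = d + i - j"
          using True ij by (auto simp: s_def q_def)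
        ultimately show ?thesis by auto
      qed
      finally show ?thesis using True by simp
    next
      case False
      define s where "s = 2 * d - 1 - i"
      have s: "s < d" "q i = s" using False ij by (auto simp: s_def q_def)
      then have "prod_poly d f g 2 (q i) = monom 1 s * g" by (simp add: prod_poly_def)
      then have "coeff (prod_poly d f g 2 (q i)) (q j) = (if s \<le> q j then coeff g (q j - s) else 0)"
        by (simp add: coeff_monom_mult)
      also have "\<dots> = (if i - d \<le> j \<and> j \<le> i then coeff g (i - j) else 0)"
      proof -
        have "coeff g (i - j) = 0" if "j < i - d" using that g by (intro coeff_eq_0) auto
        moreover have "s \<le> q j \<longleftrightarrow> j \<le> i" "q j - s = i - j"
          using ij by (auto simp: s_def q_def)
        ultimately show ?thesis by auto
      qed
      finally show ?thesis using False by simp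
    qed
    then show "sylvester_mat_sub d d f g $$ (i, j) =
        mat (2 * d) (2 * d) (\<lambda>(i, j). coeff (prod_poly d f g 2 (q i)) (q j)) $$ (i, j)"
      using ij by (simp add: sylvester_mat_sub_index)
  qed auto
  also have "av \<dots> = av (fdet (2 * d) (\<lambda>r j. coeff (prod_poly d f g 2 r) j))"
    by (simp add: av_fdet_reindex_rows[OF q inj, where A = "\<lambda>i j. coeff (prod_poly d f g 2 i) (q j)"]
        av_fdet_reindex_cols[OF q inj, where A = "\<lambda>i j. coeff (prod_poly d f g 2 i) j"])
  finally show ?thesis .
qed

text \<open>Dehomogenising can lower the degree of one form, so the divisor is chosen as one that
  attains d; comparison with n = 2 identifies the base as the resultant for formal degrees.\<close>

lemma av_fdet_prod_poly:
  assumes f: "degree f \<le> d" and g: "degree g \<le> d" and d: "d > 0"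
    and max: "degree f = d \<or> degree g = d"
  shows "av (fdet (n * d) (\<lambda>r j. coeff (prod_poly d f g n r) j)) =
    av (resultant_sub d d f g) ^ (n * (n - 1) div 2)"
proof -
  have *: "av (fdet (n * d) (\<lambda>r j. coeff (prod_poly d f g n r) j)) =
    av (fdet (2 * d) (\<lambda>r j. coeff (prod_poly d f g 2 r) j)) ^ (n * (n - 1) div 2)"
    if "degree f = d" "degree g \<le> d" for f g
    using fdet_prod_poly[OF that d, of n] fdet_prod_poly[OF that d, of 2] by (simp add: av_power)
  show ?thesis
  proof (cases "degree f = d")
    case True
    then show ?thesis using * g av_resultant_sub[OF f g d] by simp
  next
    case False
    then have "degree g = d" using max by simp
    then show ?thesis
      using *[of g f] f av_resultant_sub[OF f g d]
        av_fdet_prod_poly_swap[OF d, of n f g] av_fdet_prod_poly_swap[OF d, of 2 f g] by simp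
  qed
qed

end

text \<open>A nonzero combination of least degree divides every combination, hence both f and g, and
  so is a unit.\<close>

lemma poly_bezout:
  fixes f g :: "'a::field poly"
  assumes "coprime f g"
  shows "\<exists>u v. u * f + v * g = 1"
proof -
  define P where "P h \<longleftrightarrow> h \<noteq> 0 \<and> (\<exists>u v. h = u * f + v * g)" for h
  have "f \<noteq> 0 \<or> g \<noteq> 0" using assms by auto
  moreover have "f = 1 * f + 0 * g" "g = 0 * f + 1 * g" by simp_all
  ultimately have "P f \<or> P g" unfolding P_def by blast
  then obtain h where h: "P h" "\<And>k. P k \<Longrightarrow> degree h \<le> degree k"
    using ex_has_least_nat[of P _ degree] by blast
  then obtain u v where uv: "h = u * f + v * g" "h \<noteq> 0" by (auto simp: P_def)
  have dvd: "h dvd k" if "k = u' * f + v' * g" for k u' v'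
  proof (rule ccontr)
    assume "\<not> h dvd k"
    then have nz: "k mod h \<noteq> 0" by (simp add: dvd_eq_mod_eq_0)
    have "k mod h = k - k div h * h" by (simp add: minus_div_mult_eq_mod)
    also have "\<dots> = (u' - k div h * u) * f + (v' - k div h * v) * g"
      by (subst that, subst (2) uv(1)) (simp add: algebra_simps)
    finally have "P (k mod h)" using nz unfolding P_def by blast
    then have "degree h \<le> degree (k mod h)" by (rule h(2))
    then show False using degree_mod_less'[OF uv(2) nz] by simp
  qed
  have "h dvd f" by (rule dvd[of f 1 0]) simp
  moreover have "h dvd g" by (rule dvd[of g 0 1]) simp
  ultimately have "is_unit h" using coprime_common_divisor[OF assms] by blast
  then obtain c where "1 = h * c" by (rule dvdE)
  then have "(c * u) * f + (c * v) * g = 1" by (simp add: uv(1) algebra_simps)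
  then show ?thesis by blast
qed

text \<open>By Bezout g is invertible modulo f, and the determinant of multiplication is
  multiplicative with value 1 at 1.\<close>

lemma fdet_mod_mat_nonzero:
  fixes f :: "'a::field poly"
  assumes f: "degree f = d" "d > 0" and "coprime f g"
  shows "fdet d (mod_mat f g) \<noteq> 0"
proof -
  obtain u v where "u * f + v * g = 1" 
    using poly_bezout[OF assms(3)] by blast
  then have "(v * g) mod f = 1 mod f"
    by (metis add.commute mod_mult_self2 mult.commute)
  then have "(monom 1 i * (v * g)) mod f = (monom 1 i * 1) mod f" for i
    by (rule mod_mult_cong[OF refl])
  then have "fdet d (mod_mat f (v * g)) = fdet d (mod_mat f 1)"
    by (intro fdet_cong) (simp add: mod_mat_def)
  then show ?thesis by (auto simp: fdet_mod_mat_one[OF f] fdet_mod_mat_mult[OF f])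
qed

section \<open>Binary forms, Kronecker products and Vandermonde determinants\<close>

text \<open>The value of the binary form y^m p(x/y). The formal degree m is explicit because it may
  exceed the degree of p, and then the form is divisible by y.\<close>

definition heval :: "nat \<Rightarrow> 'a::field poly \<Rightarrow> 'a \<Rightarrow> 'a \<Rightarrow> 'a" where
  "heval m p a b = (\<Sum>j\<le>m. coeff p j * a ^ j * b ^ (m - j))"

lemma heval_nonzero:
  assumes "degree p \<le> m" "b \<noteq> 0"
  shows "heval m p a b = b ^ m * poly p (a / b)"
proof -
  have "b ^ m * poly p (a / b) = (\<Sum>j\<le>m. b ^ m * (coeff p j * (a / b) ^ j))"
    unfolding poly_altdef sum_distrib_left
    using assms by (intro sum.mono_neutral_left) (auto simp: coeff_eq_0)
  also have "\<dots> = heval m p a b"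
    unfolding heval_def using assms
    by (intro sum.cong) (auto simp: power_divide power_diff)
  finally show ?thesis ..
qed

lemma heval_zero: "heval m p a 0 = coeff p m * a ^ m"
proof -
  have "heval m p a 0 = (\<Sum>j\<le>m. if j = m then coeff p m * a ^ m else 0)"
    unfolding heval_def by (intro sum.cong) (auto simp: power_0_left)
  then show ?thesis by simp
qed

lemma coeff_mult_sum_bounds:
  assumes "degree p \<le> m" "degree q \<le> n"
  shows "coeff (p * q) (m + n) = coeff p m * coeff q n"
proof (cases "degree p = m \<and> degree q = n")
  case True
  then show ?thesis using coeff_mult_degree_sum[of p q] by auto
next
  case False
  then have "degree p + degree q < m + n" using assms by auto
  then have "degree (p * q) < m + n" using degree_mult_le[of p q] by simp
  then show ?thesis using False assms by (auto simp: coeff_eq_0)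
qed

text \<open>For b \<noteq> 0 this is evaluation of p q at a/b, scaled; at b = 0 only the
  coefficients at the formal degrees survive, and these multiply even if a degree drops.\<close>

lemma heval_mult:
  fixes p q :: "'a::field poly"
  assumes "degree p \<le> m" "degree q \<le> n"
  shows "heval (m + n) (p * q) a b = heval m p a b * heval n q a b"
proof (cases "b = 0")
  case True
  then show ?thesis using coeff_mult_sum_bounds[OF assms] by (simp add: heval_zero power_add)
next
  case False
  moreover have "degree (p * q) \<le> m + n"
    using degree_mult_le[of p q] assms by simp
  ultimately show ?thesis using assms by (simp add: heval_nonzero power_add)
qed

lemma heval_power:
  fixes p :: "'a::field poly"
  assumes "degree p \<le> m"
  shows "heval (m * n) (p ^ n) a b = heval m p a b ^ n"
proof (induction n)
  case 0
  show ?case by (simp add: heval_def)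
next
  case (Suc n)
  then show ?case
    using heval_mult[OF assms degree_power_le_mult[OF assms], of n a b] by simp
qed

lemma heval_monom:
  assumes "i \<le> m"
  shows "heval m (monom 1 i) a b = a ^ i * b ^ (m - i)"
proof -
  have "heval m (monom 1 i) a b = (\<Sum>j\<le>m. if j = i then a ^ i * b ^ (m - i) else 0)"
    unfolding heval_def by (intro sum.cong) auto
  then show ?thesis using assms by simp
qed

text \<open>With a' = r div d the formal degrees add up, n d - 1 = (d-1) + d a' + d(n-1-a'), so
  homogenisation distributes over the product.\<close>

lemma heval_prod_poly:
  assumes "degree f \<le> d" "degree g \<le> d" "d > 0" "r < n * d"
  shows "(\<Sum>j<n * d. coeff (prod_poly d f g n r) j * a ^ j * b ^ (n * d - 1 - j)) =
    a ^ (r mod d) * b ^ (d - 1 - r mod d) * heval d f a b ^ (r div d) * heval d g a b ^ (n - 1 - r div d)"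
proof -
  have a: "r div d < n" using assms by (simp add: less_mult_imp_div_less)
  have i: "r mod d \<le> d - 1" using mod_less_divisor[OF assms(3), of r] by simp
  have n: "n * d - 1 = (d - 1) + d * (r div d) + d * (n - 1 - r div d)"
  proof -
    have "d * (r div d) + d * (n - 1 - r div d) = d * (n - 1)"
      using a by (simp flip: add_mult_distrib2)
    then show ?thesis using a assms(3) by (cases n) (auto simp: algebra_simps)
  qed
  have deg: "degree (monom (1::'a) (r mod d) * f ^ (r div d)) \<le> (d - 1) + d * (r div d)"
    using i by (intro order_trans[OF degree_mult_le] add_mono degree_power_le_mult assms(1))
      (simp add: degree_monom_eq)
  have "{..<n * d} = {..n * d - 1}" using a assms(3) by (cases n) auto
  then have "(\<Sum>j<n * d. coeff (prod_poly d f g n r) j * a ^ j * b ^ (n * d - 1 - j)) =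
      heval (n * d - 1) (prod_poly d f g n r) a b"
    by (simp add: heval_def)
  also have "\<dots> = a ^ (r mod d) * b ^ (d - 1 - r mod d) * heval d f a b ^ (r div d) *
      heval d g a b ^ (n - 1 - r div d)"
    unfolding prod_poly_def n heval_mult[OF deg degree_power_le_mult[OF assms(2)]]
      heval_mult[OF degree_monom_le[THEN order_trans, OF i] degree_power_le_mult[OF assms(1)]]
      heval_power[OF assms(1)] heval_power[OF assms(2)] heval_monom[OF i] ..
  finally show ?thesis .
qed

context abs_val
begin

text \<open>After a permutation of rows and columns, the Kronecker product of \<open>A\<close> with the identity
  is block diagonal.\<close>

lemma av_fdet_kronecker:
  assumes "d > 0"
  shows "av (fdet (n * d) (\<lambda>r s. if r mod d = s mod d then A (r div d) (s div d) else 0)) =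
    av (fdet n A) ^ d"
proof (cases "n = 0")
  case True
  then show ?thesis by (simp add: fdet_def)
next
  case False
  \<comment> \<open>\<open>q\<close> sends a + n i to i + d a, which gathers each copy of
    \<open>A\<close> into one diagonal block.\<close>
  define q where "q u = u div n + d * (u mod n)" for u
  define K where "K r s = (if r mod d = s mod d then A (r div d) (s div d) else 0)" for r s
  have q: "q u mod d = u div n" "q u div d = u mod n" if "u < n * d" for u
  proof -
    have "u div n < d" using that by (simp add: less_mult_imp_div_less mult.commute)
    then show "q u mod d = u div n" "q u div d = u mod n" by (auto simp: q_def)
  qed
  have ql: "q u < n * d" if "u < n * d" for u
    using q(2)[OF that] False assms by (metis div_less_iff_less_mult mod_less_divisor neq0_conv)
  have inj: "inj_on q {0..<n * d}"
  proof (rule inj_onI)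
    fix r s assume rs: "r \<in> {0..<n * d}" "s \<in> {0..<n * d}" "q r = q s"
    then have "r div n = s div n" "r mod n = s mod n"
      using q[of r] q[of s] by auto
    then show "r = s" by (metis div_mult_mod_eq)
  qed
  have blk: "fdet (e * n) (\<lambda>u w. if u div n = w div n then A (u mod n) (w mod n) else 0) =
    fdet n A ^ e" for e
  proof (induction e)
    case 0
    show ?case by (simp add: fdet_def)
  next
    case (Suc e)
    have "fdet (n + e * n) (\<lambda>u w. if u div n = w div n then A (u mod n) (w mod n) else 0) =
      fdet n (\<lambda>u w. if u div n = w div n then A (u mod n) (w mod n) else 0) *
      fdet (e * n) (\<lambda>u w. if (n + u) div n = (n + w) div n then A ((n + u) mod n) ((n + w) mod n) else 0)"
      using False by (intro fdet_block_lower) auto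
    also have "fdet n (\<lambda>u w. if u div n = w div n then A (u mod n) (w mod n) else 0) = fdet n A"
      by (rule fdet_cong) auto
    also have "fdet (e * n) (\<lambda>u w. if (n + u) div n = (n + w) div n then A ((n + u) mod n) ((n + w) mod n) else 0)
      = fdet n A ^ e"
      using False by (subst Suc.IH[symmetric], intro fdet_cong) auto
    finally show ?case by simp
  qed
  have "av (fdet (n * d) K) = av (fdet (n * d) (\<lambda>u w. K (q u) (q w)))"
    by (simp add: av_fdet_reindex_rows[OF ql inj, where A = "\<lambda>i j. K i (q j)"]
        av_fdet_reindex_cols[OF ql inj, where A = K])
  also have "fdet (n * d) (\<lambda>u w. K (q u) (q w)) =
    fdet (d * n) (\<lambda>u w. if u div n = w div n then A (u mod n) (w mod n) else 0)"
    unfolding mult.commute[of d n] by (rule fdet_cong) (auto simp: K_def q)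
  finally show ?thesis unfolding blk K_def av_power .
qed

text \<open>Homogeneous column reduction: y_n times column m+1 minus x_n times column m has the
  factor x_i y_n - y_i x_n in row i, so it vanishes in row n. The reduction needs x_n \<noteq> 0;
  otherwise the coordinates are exchanged by reversing the columns.\<close>

lemma av_fdet_vandermonde:
  assumes "\<And>i. i < n \<Longrightarrow> x i \<noteq> 0 \<or> y i \<noteq> (0::'a)"
  shows "av (fdet n (\<lambda>i m. x i ^ m * y i ^ (n - 1 - m))) =
    (\<Prod>i<n. \<Prod>j<i. av (x i * y j - y i * x j))"
  using assms
proof (induction n)
  case 0
  show ?case by (simp add: fdet_def)
next
  case (Suc n)
  have step: "av (fdet (Suc n) (\<lambda>i m. x i ^ m * y i ^ (n - m))) =
      av (fdet n (\<lambda>i m. x i ^ m * y i ^ (n - 1 - m))) * (\<Prod>j<n. av (x n * y j - y n * x j))"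
    if nz: "x n \<noteq> 0" for x y :: "nat \<Rightarrow> 'a"
  proof -
    \<comment> \<open>\<open>U\<close> performs these operations and keeps the last column. Its
      determinant (-x_n)^n cancels the corner entry x_n^n up to sign.\<close>
    define U where "U k m = (if m = n then if k = n then 1 else 0
      else if k = m then - x n else if k = Suc m then y n else 0)" for k m
    define V where "V i m = x i ^ m * y i ^ (n - m)" for i m
    define W where "W i m = (if m = n then V i n else x i ^ m * y i ^ (n - 1 - m) * (x i * y n - y i * x n))" for i m
    have "fdet (Suc n) V * fdet (Suc n) U = fdet (Suc n) (\<lambda>i m. \<Sum>k<Suc n. V i k * U k m)"
      by (rule fdet_mult[symmetric])
    also have "\<dots> = fdet (n + 1) W"
      unfolding Suc_eq_plus1
    proof (rule fdet_cong)
      fix i m assume m: "m < n + 1"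
      show "(\<Sum>k<n + 1. V i k * U k m) = W i m"
      proof (cases "m = n")
        case True
        then have "(\<Sum>k<n + 1. V i k * U k m) = V i n"
          by (simp add: U_def if_distrib[of "(*) _"] cong: if_cong)
        then show ?thesis using True by (simp add: W_def)
      next
        case False
        then have "m < n" using m by simp
        have "(\<Sum>k<n + 1. V i k * U k m) = (\<Sum>k\<in>{m, Suc m}. V i k * U k m)"
          using \<open>m < n\<close> by (intro sum.mono_neutral_right) (auto simp: U_def)
        also have "\<dots> = - (V i m * x n) + V i (Suc m) * y n"
          using False by (simp add: U_def)
        also have "\<dots> = W i m"
        proof -
          obtain k where "n - m = Suc k" "n - Suc m = k" "n - 1 - m = k"
            using \<open>m < n\<close> by (metis Suc_diff_Suc diff_diff_left plus_1_eq_Suc)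
          then show ?thesis using False by (simp add: V_def W_def algebra_simps)
        qed
        finally show ?thesis .
      qed
    qed
    also have "\<dots> = fdet n W * fdet 1 (\<lambda>i j. W (n + i) (n + j))"
      by (rule fdet_block_upper) (simp add: W_def)
    also have "fdet 1 (\<lambda>i j. W (n + i) (n + j)) = x n ^ n"
      by (subst fdet_lower_triangular) (auto simp: W_def V_def)
    also have "fdet n W = fdet n (\<lambda>i m. (x i * y n - y i * x n) * (x i ^ m * y i ^ (n - 1 - m)))"
      by (rule fdet_cong) (simp add: W_def mult_ac)
    also have "\<dots> = (\<Prod>i<n. x i * y n - y i * x n) * fdet n (\<lambda>i m. x i ^ m * y i ^ (n - 1 - m))"
      by (rule fdet_scale_rows)
    also have "fdet (Suc n) U = (- x n) ^ n"
      by (subst fdet_lower_triangular) (auto simp: U_def)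
    finally have "av (fdet (Suc n) V) * av (x n) ^ n =
      (\<Prod>i<n. av (x i * y n - y i * x n)) * av (fdet n (\<lambda>i m. x i ^ m * y i ^ (n - 1 - m))) * av (x n) ^ n"
      by (metis av_minus av_mult av_power av_prod)
    then have "av (fdet (Suc n) V) =
      (\<Prod>i<n. av (x i * y n - y i * x n)) * av (fdet n (\<lambda>i m. x i ^ m * y i ^ (n - 1 - m)))"
      using nz by simp
    also have "(\<Prod>i<n. av (x i * y n - y i * x n)) = (\<Prod>j<n. av (x n * y j - y n * x j))"
      by (rule prod.cong[OF refl], subst av_minus[symmetric]) (simp add: algebra_simps)
    finally show ?thesis by (simp add: V_def[abs_def])
  qed
  have rev: "av (fdet m (\<lambda>i k. x i ^ k * y i ^ (m - 1 - k))) = av (fdet m (\<lambda>i k. y i ^ k * x i ^ (m - 1 - k)))"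
    for m
  proof -
    have "fdet m (\<lambda>i k. y i ^ (m - 1 - k) * x i ^ (m - 1 - (m - 1 - k))) = fdet m (\<lambda>i k. x i ^ k * y i ^ (m - 1 - k))"
      by (rule fdet_cong) (simp add: mult.commute)
    moreover have "inj_on (\<lambda>k. m - 1 - k) {0..<m}" by (auto simp: inj_on_def)
    ultimately show ?thesis
      using av_fdet_reindex_cols[of m "\<lambda>k. m - 1 - k" "\<lambda>i k. y i ^ k * x i ^ (m - 1 - k)"]
      by simp
  qed
  have "av (fdet (Suc n) (\<lambda>i m. x i ^ m * y i ^ (n - m))) =
      av (fdet n (\<lambda>i m. x i ^ m * y i ^ (n - 1 - m))) * (\<Prod>j<n. av (x n * y j - y n * x j))"
  proof (cases "x n = 0")
    case False
    then show ?thesis by (rule step)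
  next
    case True
    then have "y n \<noteq> 0" using Suc.prems[of n] by auto
    have "(\<Prod>j<n. av (y n * x j - x n * y j)) = (\<Prod>j<n. av (x n * y j - y n * x j))"
      by (rule prod.cong[OF refl], subst av_minus[symmetric]) (simp add: algebra_simps)
    then show ?thesis using step[of y x, OF \<open>y n \<noteq> 0\<close>] rev[of "Suc n"] rev[of n] by simp
  qed
  then show ?case using Suc by (simp add: mult.commute)
qed

end

section \<open>Lifts and the filled Julia set\<close>

lemma coeff_homogeneous:
  assumes "homogeneous d P"
  shows "coeff P i = (if i \<le> d then monom (coeff (dehom P) i) (d - i) else 0)"
proof -
  define c where "c = coeff (coeff P i) (d - i)"
  have "coeff P i = (if i \<le> d then monom c (d - i) else 0)"
  proof (rule poly_eqI)
    fix j
    show "coeff (coeff P i) j = coeff (if i \<le> d then monom c (d - i) else 0) j"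
    proof (cases "coeff (coeff P i) j = 0")
      case False
      then have "i + j = d" using assms by (auto simp: homogeneous_def)
      then show ?thesis by (auto simp: c_def)
    qed (auto simp: c_def)
  qed
  moreover have "coeff (dehom P) i = poly (coeff P i) 1"
    by (simp add: dehom_def coeff_map_poly)
  ultimately show ?thesis by (auto simp: poly_monom)
qed

lemma degree_dehom:
  assumes "homogeneous d P"
  shows "degree (dehom P) \<le> d"
  using coeff_homogeneous[OF assms] by (intro degree_le) (auto simp: dehom_def coeff_map_poly)

lemma eval2_eq_heval:
  assumes "homogeneous d P"
  shows "eval2 P a b = heval d (dehom P) a b"
proof -
  have "degree P \<le> d" using coeff_homogeneous[OF assms] by (intro degree_le) auto
  then have "poly P [:a:] = (\<Sum>i\<le>d. coeff P i * [:a:] ^ i)"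
    unfolding poly_altdef by (intro sum.mono_neutral_left) (auto simp: coeff_eq_0)
  then have "eval2 P a b = (\<Sum>i\<le>d. poly (coeff P i) b * a ^ i)"
    by (simp add: eval2_def poly_sum poly_power)
  also have "\<dots> = heval d (dehom P) a b"
    unfolding heval_def
    by (intro sum.cong refl, subst coeff_homogeneous[OF assms]) (auto simp: poly_monom mult_ac)
  finally show ?thesis .
qed

text \<open>From f q = p g and u p + v q = 1, the polynomial h = u f + v g satisfies f = p h and g =
  q h. One of p, q already has degree d, so the degree bounds force h to be constant.\<close>

lemma coprime_of_lowest_terms:
  assumes \<phi>: "ratfun_has_degree \<phi> d" "\<phi> = Fract f g" and d: "d > 0"
    and deg: "degree f \<le> d" "degree g \<le> d"
  shows "coprime f g" "degree f = d \<or> degree g = d"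
proof -
  obtain p q where pq: "q \<noteq> 0" "coprime p q" "\<phi> = Fract p q" "d = max (degree p) (degree q)"
    using \<phi>(1) by (auto simp: ratfun_has_degree_def)
  have g: "g \<noteq> 0"
  proof
    assume "g = 0"
    then have "Fract p q = Fract 0 1" using \<phi>(2) pq(3) by (simp add: eq_fract)
    then have "p = 0" using pq(1) by (simp add: eq_fract)
    then have "is_unit q" using pq(2) by simp
    then have "degree q = 0" using pq(1) by (simp add: is_unit_iff_degree)
    then show False using pq(4) \<open>p = 0\<close> d by simp
  qed
  then have eq: "f * q = p * g" using \<phi>(2) pq by (simp add: eq_fract)
  obtain u v where uv: "u * p + v * q = 1" using poly_bezout[OF pq(2)] by blast
  define h where "h = u * f + v * g"
  have f: "p * h = f"
  proof -
    have "p * h = u * p * f + v * (p * g)" by (simp add: h_def algebra_simps)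
    also have "\<dots> = (u * p + v * q) * f" unfolding eq[symmetric] by (simp add: algebra_simps)
    finally show ?thesis by (simp add: uv)
  qed
  have g': "q * h = g"
  proof -
    have "q * h = u * (f * q) + v * q * g" by (simp add: h_def algebra_simps)
    also have "\<dots> = (u * p + v * q) * g" unfolding eq by (simp add: algebra_simps)
    finally show ?thesis by (simp add: uv)
  qed
  have h0: "h \<noteq> 0" using g g' by auto
  have h: "degree h = 0 \<and> (degree f = d \<or> degree g = d)"
  proof (cases "degree p = d")
    case True
    then have "p \<noteq> 0" using d by auto
    then have "degree f = degree p + degree h" using f h0 degree_mult_eq[of p h] by auto
    then show ?thesis using True deg by auto
  next
    case False
    then have q: "degree q = d" using pq(4) by (auto simp: max_def split: if_splits)
    have "degree g = degree q + degree h" using g' h0 pq(1) degree_mult_eq[of q h] by auto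
    then show ?thesis using q deg by auto
  qed
  then show "degree f = d \<or> degree g = d" by simp
  have "is_unit h" using h h0 by (simp add: is_unit_iff_degree)
  show "coprime f g"
  proof (rule coprimeI)
    fix c assume "c dvd f" "c dvd g"
    then have "c dvd h" by (simp add: h_def)
    then show "is_unit c" using \<open>is_unit h\<close> dvd_trans by blast
  qed
qed

lemma fdet_inverse:
  fixes A :: "nat \<Rightarrow> nat \<Rightarrow> 'a::field"
  assumes "fdet n A \<noteq> 0"
  shows "\<exists>B. \<forall>i<n. \<forall>j<n. (\<Sum>k<n. B i k * A k j) = (if i = j then 1 else 0)"
proof -
  define M where "M = mat n n (\<lambda>(i, j). A i j)"
  have M: "M \<in> carrier_mat n n" by (simp add: M_def)
  have "det M \<noteq> 0" using assms by (simp add: M_def fdet_def)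
  then have "M \<in> Units (ring_mat TYPE('a) n ())" by (rule det_non_zero_imp_unit[OF M])
  then obtain B where B: "B \<in> carrier_mat n n" "B * M = 1\<^sub>m n"
    by (auto simp: Units_def ring_mat_def)
  have "(\<Sum>k<n. B $$ (i, k) * A k j) = (if i = j then 1 else 0)" if ij: "i < n" "j < n" for i j
  proof -
    have "(B * M) $$ (i, j) = (\<Sum>k<n. B $$ (i, k) * A k j)"
      using ij B(1) by (simp add: M_def scalar_prod_def lessThan_atLeast0)
    then show ?thesis using ij by (simp add: B(2))
  qed
  then show ?thesis by (intro exI[of _ "\<lambda>i k. B $$ (i, k)"]) auto
qed

context abs_val
begin

lemma resultant_sub_nonzero:
  fixes f g :: "'a poly"
  assumes f: "degree f \<le> d" and g: "degree g \<le> d" and d: "d > 0"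
    and max: "degree f = d \<or> degree g = d" and cop: "coprime f g"
  shows "resultant_sub d d f g \<noteq> 0"
proof -
  have nz: "fdet (2 * d) (\<lambda>r j. coeff (prod_poly d p q 2 r) j) \<noteq> 0"
    if "degree p = d" "degree q \<le> d" "coprime p q" for p q :: "'a poly"
    using fdet_prod_poly[OF that(1,2) d, of 2] fdet_mod_mat_nonzero[OF that(1) d that(3)] that(1) d
    by auto
  have "av (fdet (2 * d) (\<lambda>r j. coeff (prod_poly d f g 2 r) j)) \<noteq> 0"
  proof (cases "degree f = d")
    case True
    then show ?thesis using nz[OF True g cop] by simp
  next
    case False
    then have "degree g = d" using max by simp
    then show ?thesis
      using nz[of g f] f cop av_fdet_prod_poly_swap[OF d, of 2 f g] by (simp add: coprime_commute)
  qed
  then show ?thesis using av_resultant_sub[OF f g d] av_zero by metis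
qed

section \<open>Boundedness of the filled Julia set\<close>

lemma av_monomial_le:
  assumes "av a \<le> R" "av b \<le> R" "i \<le> n"
  shows "av (a ^ i * b ^ (n - i)) \<le> R ^ n"
proof -
  have "R \<ge> 0" using assms(1) av_nonneg[of a] by linarith
  then have "av a ^ i * av b ^ (n - i) \<le> R ^ i * R ^ (n - i)"
    using assms by (intro mult_mono power_mono) auto
  then show ?thesis using assms(3) by (simp add: av_mult av_power flip: power_add)
qed

text \<open>Inverting the Sylvester matrix writes every monomial of degree 2d - 1 as a combination
  of monomials of degree d - 1 times a component of F. Hence ||z||^(2d-1) \<le> C ||z||^(d-1)
  ||F(z)||, and ||z||^(d-1) cancels.\<close>

lemma vnorm_heval_lower_bound:
  fixes f g :: "'a poly"
  assumes f: "degree f \<le> d" and g: "degree g \<le> d" and d: "d > 0"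
    and res: "resultant_sub d d f g \<noteq> 0"
  shows "\<exists>C>0. \<forall>a b. vnorm av (a, b) ^ d \<le> C * vnorm av (heval d f a b, heval d g a b)"
proof -
  define D where "D r j = coeff (prod_poly d f g 2 r) j" for r j
  have "av (fdet (2 * d) D) \<noteq> 0"
    unfolding D_def[abs_def] av_resultant_sub[OF f g d, symmetric] using res by simp
  then have "fdet (2 * d) D \<noteq> 0" by simp
  then obtain B where B: "\<And>i j. i < 2 * d \<Longrightarrow> j < 2 * d \<Longrightarrow>
      (\<Sum>k<2 * d. B i k * D k j) = (if i = j then 1 else 0)"
    using fdet_inverse by blast
  define C where "C = 1 + (\<Sum>m<2 * d. \<Sum>r<2 * d. av (B m r))"
  have "C > 0" unfolding C_def by (intro add_pos_nonneg sum_nonneg) auto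
  moreover have "vnorm av (a, b) ^ d \<le> C * vnorm av (heval d f a b, heval d g a b)" for a b
  proof (cases "vnorm av (a, b) = 0")
    case True
    have "0 \<le> vnorm av (heval d f a b, heval d g a b)" by (simp add: vnorm_def le_max_iff_disj)
    then show ?thesis using True d \<open>C > 0\<close> by (simp add: power_0_left)
  next
    case False
    define M where "M = vnorm av (a, b)"
    define Y where "Y = vnorm av (heval d f a b, heval d g a b)"
    have M: "M > 0" "av a \<le> M" "av b \<le> M"
      using False by (auto simp: M_def vnorm_def less_max_iff_disj av_pos max_def split: if_splits)
    have Y: "Y \<ge> 0" "av (heval d f a b) \<le> Y" "av (heval d g a b) \<le> Y"
      by (auto simp: Y_def vnorm_def le_max_iff_disj)
    define E where "E r = a ^ (r mod d) * b ^ (d - 1 - r mod d) *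
      (heval d f a b ^ (r div d) * heval d g a b ^ (1 - r div d))" for r
    have E: "av (E r) \<le> M ^ (d - 1) * Y" if "r < 2 * d" for r
    proof -
      have "r div d < 2" using that by (rule less_mult_imp_div_less)
      then have "av (heval d f a b ^ (r div d) * heval d g a b ^ (1 - r div d)) \<le> Y ^ 1"
        using Y by (intro av_monomial_le) auto
      moreover have "av (a ^ (r mod d) * b ^ (d - 1 - r mod d)) \<le> M ^ (d - 1)"
        using M mod_less_divisor[OF d, of r] by (intro av_monomial_le) auto
      ultimately have "av (a ^ (r mod d) * b ^ (d - 1 - r mod d)) *
        av (heval d f a b ^ (r div d) * heval d g a b ^ (1 - r div d)) \<le> M ^ (d - 1) * Y"
        using M by (intro mult_mono) auto
      then show ?thesis by (simp only: E_def av_mult)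
    qed
    have mono: "av (a ^ m * b ^ (2 * d - 1 - m)) \<le> C * (M ^ (d - 1) * Y)" if m: "m < 2 * d" for m
    proof -
      have "a ^ m * b ^ (2 * d - 1 - m) = (\<Sum>j<2 * d. (if m = j then 1 else 0) * (a ^ j * b ^ (2 * d - 1 - j)))"
        using m by (simp add: if_distrib[of "\<lambda>x. x * _"] cong: if_cong)
      also have "\<dots> = (\<Sum>j<2 * d. \<Sum>r<2 * d. B m r * (D r j * a ^ j * b ^ (2 * d - 1 - j)))"
        by (intro sum.cong refl) (simp add: B[OF m, symmetric] sum_distrib_right mult.assoc)
      also have "\<dots> = (\<Sum>r<2 * d. B m r * (\<Sum>j<2 * d. D r j * a ^ j * b ^ (2 * d - 1 - j)))"
        by (subst sum.swap) (simp add: sum_distrib_left)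
      also have "\<dots> = (\<Sum>r<2 * d. B m r * E r)"
        using heval_prod_poly[OF f g d, of _ 2 a b]
        by (intro sum.cong refl) (simp add: D_def E_def mult.assoc)
      also have "av \<dots> \<le> (\<Sum>r<2 * d. av (B m r) * (M ^ (d - 1) * Y))"
        using E by (intro order_trans[OF av_sum] sum_mono) (auto simp: av_mult intro!: mult_left_mono)
      also have "\<dots> = (\<Sum>r<2 * d. av (B m r)) * (M ^ (d - 1) * Y)" by (simp add: sum_distrib_right)
      also have "\<dots> \<le> C * (M ^ (d - 1) * Y)"
      proof (rule mult_right_mono)
        have "(\<Sum>r<2 * d. av (B m r)) \<le> (\<Sum>m<2 * d. \<Sum>r<2 * d. av (B m r))"
          using m by (intro member_le_sum[of m "{..<2 * d}" "\<lambda>m. \<Sum>r<2 * d. av (B m r)"]) (auto intro: sum_nonneg)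
        then show "(\<Sum>r<2 * d. av (B m r)) \<le> C" by (simp add: C_def)
      qed (use M Y in auto)
      finally show ?thesis .
    qed
    \<comment> \<open>The pure powers of a and b, at m = 2d - 1 and m = 0, suffice: the larger of
      them has absolute value \<open>M ^ (2 * d - 1)\<close>.\<close>
    have "M ^ (2 * d - 1) \<le> C * (M ^ (d - 1) * Y)"
      using mono[of "2 * d - 1"] mono[of 0] d
      by (auto simp: M_def vnorm_def max_def av_power)
    moreover have "2 * d - 1 = d + (d - 1)" using d by simp
    ultimately have "M ^ d * M ^ (d - 1) \<le> (C * Y) * M ^ (d - 1)"
      by (simp add: power_add mult_ac)
    then show ?thesis using M by (simp add: M_def Y_def)
  qed
  ultimately show ?thesis by blast
qed

lemma julia_bounded:
  assumes F1: "homogeneous d F1" and F2: "homogeneous d F2" and d: "d \<ge> 2"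
    and res: "hom_resultant d F1 F2 \<noteq> 0"
  shows "\<exists>R. \<forall>z\<in>filled_julia av F1 F2. vnorm av z \<le> R"
proof -
  have lm: "lift_map F1 F2 z = (heval d (dehom F1) (fst z) (snd z), heval d (dehom F2) (fst z) (snd z))" for z
    by (simp add: lift_map_def eval2_eq_heval[OF F1] eval2_eq_heval[OF F2])
  obtain C where C: "C > 0" "\<And>z. vnorm av z ^ d \<le> C * vnorm av (lift_map F1 F2 z)"
    using vnorm_heval_lower_bound[OF degree_dehom[OF F1] degree_dehom[OF F2]] res d
    unfolding lm hom_resultant_def by (metis gr0I not_numeral_le_zero prod.collapse)
  \<comment> \<open>An escape radius: beyond 1 the exponent d may be lowered to 2, and beyond 2C the
    quotient M^2 / C exceeds 2M, so norms at least double.\<close>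
  define R where "R = max 1 (2 * C)"
  have step: "vnorm av (lift_map F1 F2 w) \<ge> 2 * vnorm av w" if w: "vnorm av w > R" for w
  proof -
    define M where "M = vnorm av w"
    have M: "M > 1" "M > 2 * C" using w by (auto simp: R_def M_def)
    have "C * (2 * M) \<le> M * M" using M by simp
    also have "\<dots> = M ^ 2" by (simp add: power2_eq_square)
    also have "\<dots> \<le> M ^ d" using M d by (intro power_increasing) auto
    also have "\<dots> \<le> C * vnorm av (lift_map F1 F2 w)" unfolding M_def by (rule C(2))
    finally show ?thesis using C(1) by (simp add: M_def)
  qed
  have "vnorm av z \<le> R" if z: "z \<in> filled_julia av F1 F2" for z
  proof (rule ccontr)
    assume "\<not> vnorm av z \<le> R"
    then have gt: "vnorm av z > R" by simp
    have grow: "vnorm av ((lift_map F1 F2 ^^ n) z) \<ge> 2 ^ n * vnorm av z" for n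
    proof (induction n)
      case (Suc n)
      have "1 * R < 2 ^ n * vnorm av z"
        using gt one_le_power[of "2::real" n] by (intro mult_le_less_imp_less) (auto simp: R_def)
      then have "vnorm av ((lift_map F1 F2 ^^ n) z) > R" using Suc by linarith
      then show ?case using step[of "(lift_map F1 F2 ^^ n) z"] Suc by simp
    qed simp
    obtain B where B: "\<And>n. vnorm av ((lift_map F1 F2 ^^ n) z) \<le> B"
      using z by (auto simp: filled_julia_def)
    obtain n where n: "B < 2 ^ n" using real_arch_pow[of 2 B] by auto
    have "vnorm av z \<ge> 1" using gt by (simp add: R_def)
    then have "2 ^ n * 1 \<le> 2 ^ n * vnorm av z" by (intro mult_left_mono) auto
    then show False using grow[of n] B[of n] n by linarith
  qed
  then show ?thesis by blast
qed

text \<open>\<open>LEAST\<close> on the reals is informative only if the minimum is attained; for a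
  bounded nonempty set of norms it is the supremum.\<close>

lemma vnorm_le_julia_radius:
  assumes "\<exists>R. \<forall>z\<in>filled_julia av F1 F2. vnorm av z \<le> R" and z: "z \<in> filled_julia av F1 F2"
  shows "vnorm av z \<le> julia_radius av F1 F2"
proof -
  define S where "S = vnorm av ` filled_julia av F1 F2"
  have bdd: "bdd_above S" using assms(1) by (auto simp: S_def bdd_above_def)
  have "julia_radius av F1 F2 = Sup S"
    unfolding julia_radius_def
  proof (rule Least_equality)
    show "filled_julia av F1 F2 \<subseteq> {z. vnorm av z \<le> Sup S}"
      using cSup_upper[OF _ bdd] by (auto simp: S_def)
    show "Sup S \<le> R" if "filled_julia av F1 F2 \<subseteq> {z. vnorm av z \<le> R}" for R
      using that z by (intro cSup_least) (auto simp: S_def)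
  qed
  then show ?thesis using cSup_upper[OF _ bdd] z by (simp add: S_def)
qed

lemma filled_julia_lift_map:
  assumes "z \<in> filled_julia av F1 F2"
  shows "lift_map F1 F2 z \<in> filled_julia av F1 F2"
proof -
  obtain B where B: "\<And>n. vnorm av ((lift_map F1 F2 ^^ n) z) \<le> B"
    using assms by (auto simp: filled_julia_def)
  have "vnorm av ((lift_map F1 F2 ^^ n) (lift_map F1 F2 z)) \<le> B" for n
    using B[of "Suc n"] by (simp add: funpow_swap1)
  then show ?thesis by (auto simp: filled_julia_def)
qed

end

section \<open>The lower bound\<close>

lemma sum_kronecker_row:
  fixes \<phi> :: "nat \<Rightarrow> 'a::comm_ring_1"
  assumes d: "d > 0" and i: "i < d"
  shows "(\<Sum>s<n * d. if i = s mod d then \<phi> s else 0) = (\<Sum>m<n. \<phi> (m * d + i))"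
proof -
  have "(\<Sum>s<n * d. if i = s mod d then \<phi> s else 0) = (\<Sum>s | s < n * d \<and> i = s mod d. \<phi> s)"
    by (intro sum.mono_neutral_cong_right) auto
  also have "\<dots> = (\<Sum>m<n. \<phi> (m * d + i))"
  proof (rule sum.reindex_bij_witness[of _ "\<lambda>m. m * d + i" "\<lambda>s. s div d"])
    fix m assume "m \<in> {..<n}"
    then have "m * d + d \<le> n * d" by (metis Suc_leI add.commute lessThan_iff mult_Suc mult_le_mono1)
    then show "m * d + i \<in> {s. s < n * d \<and> i = s mod d}" using i by auto
  qed (use i d less_mult_imp_div_less in auto)
  finally show ?thesis .
qed

context abs_val
begin

text \<open>A basis of the forms of degree \<open>t d\<^sup>k - 1\<close> made of products of iterates of \<open>F\<close>: every
  member \<open>G\<close> of a basis for \<open>k\<close> contributes the forms \<open>x\<^sup>i y\<^bsup>d-1-i\<^esup> (G \<circ> F)\<close> to the basis for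
  \<open>k + 1\<close>. The matrix \<open>C\<close> holds the coefficients of the basis.\<close>

lemma iterate_basis_exists:
  fixes f g :: "'a poly" and S :: "('a \<times> 'a) set"
  assumes f: "degree f \<le> d" and g: "degree g \<le> d" and d: "d > 0"
    and max: "degree f = d \<or> degree g = d" and t: "t > 0"
    and S: "\<And>a b. (a, b) \<in> S \<Longrightarrow> (heval d f a b, heval d g a b) \<in> S"
    and R: "\<And>a b. (a, b) \<in> S \<Longrightarrow> av a \<le> R \<and> av b \<le> R"
  shows "\<exists>C e. av (fdet (t * d ^ k) C) = av (resultant_sub d d f g) ^ e
    \<and> 2 * real d * (real d - 1) * real e =
        real (t * d ^ k) ^ 2 - (real t + (real d - 1) * real k) * real (t * d ^ k)
    \<and> (\<forall>(a, b)\<in>S. \<forall>l<t * d ^ k. av (\<Sum>m<t * d ^ k. C l m * a ^ m * b ^ (t * d ^ k - 1 - m))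
          \<le> R ^ (t - 1 + (d - 1) * k))"
proof (induction k)
  case 0
  show ?case
  \<comment> \<open>Level 0 uses the monomials of degree t - 1 themselves; the resultant does not
    occur, and the exponent formula reads 0 = t^2 - t t.\<close>
  proof (rule exI[of _ "\<lambda>i j. if i = j then 1 else 0"], rule exI[of _ 0], intro conjI)
    show "\<forall>(a, b)\<in>S. \<forall>l<t * d ^ 0. av (\<Sum>m<t * d ^ 0. (if l = m then 1 else 0) * a ^ m * b ^ (t * d ^ 0 - 1 - m))
          \<le> R ^ (t - 1 + (d - 1) * 0)"
    proof (clarify)
      fix a b l assume ab: "(a, b) \<in> S" and "l < t * d ^ 0"
      then have "(\<Sum>m<t * d ^ 0. (if l = m then 1 else 0) * a ^ m * b ^ (t * d ^ 0 - 1 - m)) =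
        a ^ l * b ^ (t - 1 - l)"
        by (simp add: if_distrib[of "\<lambda>x. x * _"] cong: if_cong)
      then show "av (\<Sum>m<t * d ^ 0. (if l = m then 1 else 0) * a ^ m * b ^ (t * d ^ 0 - 1 - m))
          \<le> R ^ (t - 1 + (d - 1) * 0)"
        using R[OF ab] \<open>l < t * d ^ 0\<close> av_monomial_le[of a R b l "t - 1"] by simp
    qed
  qed (auto simp: fdet_one power2_eq_square)
next
  case (Suc k)
  define n where "n = t * d ^ k"
  define h where "h = t - 1 + (d - 1) * k"
  obtain C e where C: "av (fdet n C) = av (resultant_sub d d f g) ^ e"
    "2 * real d * (real d - 1) * real e = real n ^ 2 - (real t + (real d - 1) * real k) * real n"
    "\<And>a b l. (a, b) \<in> S \<Longrightarrow> l < n \<Longrightarrow> av (\<Sum>m<n. C l m * a ^ m * b ^ (n - 1 - m)) \<le> R ^ h"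
    using Suc.IH unfolding n_def h_def by fast
  have N: "t * d ^ Suc k = n * d" by (simp add: n_def)
  \<comment> \<open>\<open>K\<close> writes x^i y^(d-1-i) (G \<circ> F) through the products x^i
    y^(d-1-i) F1^m F2^(n-1-m), using the coefficients of G; \<open>D\<close> expands these products
    in monomials.\<close>
  define K where "K r s = (if r mod d = s mod d then C (r div d) (s div d) else 0)" for r s
  define D where "D r j = coeff (prod_poly d f g n r) j" for r j
  define C' where "C' r j = (\<Sum>s<n * d. K r s * D s j)" for r j
  \<comment> \<open>The Kronecker factor gives the d-th power of the old determinant, and
    \<open>D\<close> adds n(n-1)/2. The stated exponent formula is the closed form of this
    recursion.\<close>
  define e' where "e' = d * e + n * (n - 1) div 2"
  have "av (fdet (n * d) C') = av (fdet (n * d) K) * av (fdet (n * d) D)"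
    unfolding C'_def[abs_def] fdet_mult av_mult ..
  also have "av (fdet (n * d) K) = av (fdet n C) ^ d"
    unfolding K_def[abs_def] by (rule av_fdet_kronecker[OF d])
  also have "av (fdet (n * d) D) = av (resultant_sub d d f g) ^ (n * (n - 1) div 2)"
    unfolding D_def[abs_def] by (rule av_fdet_prod_poly[OF f g d max])
  finally have det: "av (fdet (n * d) C') = av (resultant_sub d d f g) ^ e'"
    by (simp add: C(1) e'_def power_add mult.commute flip: power_mult)
  have "n > 0" using t d by (simp add: n_def)
  define q where "q = n * (n - 1) div 2"
  have "2 * q = n * (n - 1)" unfolding q_def by (cases n) auto
  then have "2 * real q = real n * (real n - 1)"
    using \<open>n > 0\<close> by (metis One_nat_def Suc_leI of_nat_1 of_nat_diff of_nat_mult of_nat_numeral)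
  moreover have "2 * real d * (real d - 1) * real e' =
      real d * (2 * real d * (real d - 1) * real e) + real d * (real d - 1) * (2 * real q)"
    unfolding e'_def q_def[symmetric] by (simp add: algebra_simps)
  ultimately have "2 * real d * (real d - 1) * real e' =
    real d * (real n ^ 2 - (real t + (real d - 1) * real k) * real n) + real d * (real d - 1) * (real n * (real n - 1))"
    by (simp only: C(2))
  also have "\<dots> = real (n * d) ^ 2 - (real t + (real d - 1) * real (Suc k)) * real (n * d)"
    by (simp add: algebra_simps power2_eq_square)
  finally have e': "2 * real d * (real d - 1) * real e' =
    real (n * d) ^ 2 - (real t + (real d - 1) * real (Suc k)) * real (n * d)" .
  have bound: "av (\<Sum>j<n * d. C' r j * a ^ j * b ^ (n * d - 1 - j)) \<le> R ^ (t - 1 + (d - 1) * Suc k)"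
    if ab: "(a, b) \<in> S" and r: "r < n * d" for a b r
  proof -
    define i where "i = r mod d"
    have i: "i < d" using d by (simp add: i_def)
    define a' b' where "a' = heval d f a b" and "b' = heval d g a b"
    have "(\<Sum>j<n * d. C' r j * a ^ j * b ^ (n * d - 1 - j)) =
      (\<Sum>j<n * d. \<Sum>s<n * d. K r s * (D s j * a ^ j * b ^ (n * d - 1 - j)))"
      by (simp add: C'_def sum_distrib_right mult.assoc)
    also have "\<dots> = (\<Sum>s<n * d. K r s * (\<Sum>j<n * d. D s j * a ^ j * b ^ (n * d - 1 - j)))"
      by (subst sum.swap) (simp add: sum_distrib_left)
    also have "\<dots> = (\<Sum>s<n * d. if i = s mod d then C (r div d) (s div d) *
        (a ^ (s mod d) * b ^ (d - 1 - s mod d) * a' ^ (s div d) * b' ^ (n - 1 - s div d)) else 0)"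
      using heval_prod_poly[OF f g d, of _ n a b]
      by (intro sum.cong refl) (auto simp: D_def K_def i_def a'_def b'_def)
    \<comment> \<open>Only the s with remainder i survive, so x^i y^(d-1-i) factors out and the
      bound for level k applies at F(a, b), again a point of \<open>S\<close>.\<close>
    also have "\<dots> = (\<Sum>m<n. C (r div d) m * (a ^ i * b ^ (d - 1 - i) * a' ^ m * b' ^ (n - 1 - m)))"
      by (subst sum_kronecker_row[OF d i]) (use i in simp)
    also have "\<dots> = (a ^ i * b ^ (d - 1 - i)) * (\<Sum>m<n. C (r div d) m * a' ^ m * b' ^ (n - 1 - m))"
      by (simp add: sum_distrib_left mult_ac)
    also have "av \<dots> \<le> R ^ (d - 1) * R ^ h"
      unfolding av_mult[of "a ^ i * b ^ (d - 1 - i)"]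
    proof (rule mult_mono)
      show "av (a ^ i * b ^ (d - 1 - i)) \<le> R ^ (d - 1)"
        using R[OF ab] i by (intro av_monomial_le) auto
      have "(a', b') \<in> S" using S[OF ab] by (simp add: a'_def b'_def)
      then show "av (\<Sum>m<n. C (r div d) m * a' ^ m * b' ^ (n - 1 - m)) \<le> R ^ h"
        using r by (intro C(3)) (auto intro: less_mult_imp_div_less)
      show "0 \<le> R ^ (d - 1)" using R[OF ab] av_nonneg[of a] by (intro zero_le_power) linarith
    qed auto
    also have "\<dots> = R ^ (t - 1 + (d - 1) * Suc k)"
      by (simp add: h_def add.left_commute flip: power_add)
    finally show ?thesis .
  qed
  show ?case
    unfolding N by (rule exI[of _ C'], rule exI[of _ e']) (use det e' bound in auto)
qed

lemma wedge_nonzero: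
  fixes z w :: "'a \<times> 'a"
  assumes z: "z \<noteq> (0, 0)" and w: "w \<noteq> (0, 0)" and ne: "proj_point z \<noteq> proj_point w"
  shows "wedge z w \<noteq> 0"
proof
  assume 0: "wedge z w = 0"
  obtain x1 y1 where zz: "z = (x1, y1)" by (cases z)
  obtain x2 y2 where ww: "w = (x2, y2)" by (cases w)
  have eq: "x1 * y2 = y1 * x2" using 0 by (simp add: wedge_def zz ww)
  have "\<exists>l. l \<noteq> 0 \<and> x2 = l * x1 \<and> y2 = l * y1"
  proof (cases "x1 = 0")
    case True
    then have "y1 \<noteq> 0" "x2 = 0" "y2 \<noteq> 0" using eq z w by (auto simp: zz ww)
    then show ?thesis using True by (intro exI[of _ "y2 / y1"]) auto
  next
    case False
    have "x2 \<noteq> 0" using eq False w by (auto simp: ww)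
    then show ?thesis using False eq by (intro exI[of _ "x2 / x1"]) (auto simp: field_simps)
  qed
  then obtain l where l: "l \<noteq> 0" "x2 = l * x1" "y2 = l * y1" by blast
  have "proj_point w \<subseteq> proj_point z"
    using l by (auto simp: proj_point_def zz ww)
  moreover have "proj_point z \<subseteq> proj_point w"
  proof
    fix p assume "p \<in> proj_point z"
    then obtain c where "c \<noteq> 0" "p = (c * x1, c * y1)" by (auto simp: proj_point_def zz)
    then have "c / l \<noteq> 0" "p = (c / l * x2, c / l * y2)" using l by auto
    then show "p \<in> proj_point w" unfolding proj_point_def ww fst_conv snd_conv by blast
  qed
  ultimately show False using ne by auto
qed

end

text \<open>Symmetry folds the ordered pairs onto the triangle j < i of the Vandermonde product,
  with indices shifted to start at 0.\<close>

lemma sum_off_diagonal: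
  fixes \<phi> :: "nat \<Rightarrow> nat \<Rightarrow> real"
  assumes "\<And>i j. \<phi> i j = \<phi> j i"
  shows "(\<Sum>(i, j) \<in> {(i, j). i \<in> {1..N} \<and> j \<in> {1..N} \<and> i \<noteq> j}. \<phi> i j) =
    2 * (\<Sum>i<N. \<Sum>j<i. \<phi> (Suc i) (Suc j))"
proof -
  define A where "A = Sigma {..<N} (\<lambda>i. {..<i})"
  have A: "finite A" by (simp add: A_def)
  have "{(i, j). i \<in> {1..N} \<and> j \<in> {1..N} \<and> i \<noteq> j} =
     (\<lambda>(i, j). (Suc i, Suc j)) ` A \<union> (\<lambda>(i, j). (Suc j, Suc i)) ` A" (is "?L = ?R")
  proof (rule Set.set_eqI)
    fix p :: "nat \<times> nat"
    obtain i j where "p = (i, j)" by (cases p)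
    then show "p \<in> ?L \<longleftrightarrow> p \<in> ?R"
      by (cases i; cases j) (auto simp: A_def image_iff)
  qed
  then have "(\<Sum>(i, j) \<in> ?L. \<phi> i j) =
    (\<Sum>(i, j) \<in> (\<lambda>(i, j). (Suc i, Suc j)) ` A. \<phi> i j) + (\<Sum>(i, j) \<in> (\<lambda>(i, j). (Suc j, Suc i)) ` A. \<phi> i j)"
    using A by (simp only:, intro sum.union_disjoint) (auto simp: A_def)
  also have "(\<Sum>(i, j) \<in> (\<lambda>(i, j). (Suc i, Suc j)) ` A. \<phi> i j) = (\<Sum>(i, j)\<in>A. \<phi> (Suc i) (Suc j))"
    by (subst sum.reindex) (auto simp: inj_on_def case_prod_unfold)
  also have "(\<Sum>(i, j) \<in> (\<lambda>(i, j). (Suc j, Suc i)) ` A. \<phi> i j) = (\<Sum>(i, j)\<in>A. \<phi> (Suc i) (Suc j))"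
    by (subst sum.reindex) (auto simp: inj_on_def case_prod_unfold intro!: sum.cong assms)
  also have "(\<Sum>(i, j)\<in>A. \<phi> (Suc i) (Suc j)) = (\<Sum>i<N. \<Sum>j<i. \<phi> (Suc i) (Suc j))"
    unfolding A_def by (rule sum.Sigma[symmetric]) auto
  finally show ?thesis by simp
qed

theorem theorem2p1:
  fixes av :: "'a::field \<Rightarrow> real"
    and \<phi> :: "'a poly fract"
    and F1 F2 :: "'a poly poly"
    and d t k N :: nat
    and z :: "nat \<Rightarrow> 'a \<times> 'a"
    and \<alpha> :: real
  assumes "absolute_value av"
    and "d \<ge> 2"
    and "ratfun_has_degree \<phi> d"
    and "is_lift d \<phi> F1 F2"
    and "2 \<le> t" and "t \<le> 2 * d - 1" and "k \<ge> 1"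
    and "N = t * d ^ k"
    and "\<And>i. i \<in> {1..N} \<Longrightarrow> z i \<noteq> (0, 0)"
    and "\<And>i. i \<in> {1..N} \<Longrightarrow> z i \<in> filled_julia av F1 F2"
    and "inj_on (\<lambda>i. proj_point (z i)) {1..N}"
    and "\<alpha> = real t - 1 + (real d - 1) * real k"
  shows "(\<Sum>(i, j) \<in> {(i, j). i \<in> {1..N} \<and> j \<in> {1..N} \<and> i \<noteq> j}. - ln (av (wedge (z i) (z j))))
           \<ge> r_const av d F1 F2 * real N ^ 2
              - eps av * real N * ln (real N)
              - 2 * ln (julia_radius av F1 F2) * \<alpha> * real N
              - r_const av d F1 F2 * (1 + \<alpha>) * real N
         \<and> \<alpha> > 0 \<and> 2 \<le> \<alpha> \<and> \<alpha> \<le> (real d - 1) * (log (real d) (real N) + 2)"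
proof -
  interpret abs_val av by unfold_locales (rule assms(1))
  define f g where "f = dehom F1" and "g = dehom F2"
  define R where "R = julia_radius av F1 F2"
  define \<rho> where "\<rho> = hom_resultant d F1 F2"
  have F1: "homogeneous d F1" and F2: "homogeneous d F2" and \<phi>: "\<phi> = Fract f g"
    using assms(4) by (auto simp: is_lift_def f_def g_def)
  have d: "d > 0" using assms(2) by simp
  have f: "degree f \<le> d" and g: "degree g \<le> d"
    using degree_dehom[OF F1] degree_dehom[OF F2] by (simp_all add: f_def g_def)
  note lowest = coprime_of_lowest_terms[OF assms(3) \<phi> d f g]
  have \<rho>_eq: "\<rho> = resultant_sub d d f g" by (simp add: \<rho>_def hom_resultant_def f_def g_def)
  have \<rho>: "\<rho> \<noteq> 0" unfolding \<rho>_eq by (rule resultant_sub_nonzero[OF f g d lowest(2,1)])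
  have K: "vnorm av w \<le> R" if "w \<in> filled_julia av F1 F2" for w
    unfolding R_def
    by (rule vnorm_le_julia_radius[OF julia_bounded[OF F1 F2 assms(2)] that]) (use \<rho> in \<open>simp add: \<rho>_def\<close>)
  have KS: "(heval d f a b, heval d g a b) \<in> filled_julia av F1 F2" if "(a, b) \<in> filled_julia av F1 F2" for a b
    using filled_julia_lift_map[OF that]
    by (simp add: lift_map_def eval2_eq_heval[OF F1] eval2_eq_heval[OF F2] f_def g_def)
  have KR: "av a \<le> R \<and> av b \<le> R" if "(a, b) \<in> filled_julia av F1 F2" for a b
    using K[OF that] by (simp add: vnorm_def)
  define h where "h = t - 1 + (d - 1) * k"
  obtain C e where C: "av (fdet N C) = av \<rho> ^ e"
    "2 * real d * (real d - 1) * real e = real N ^ 2 - (real t + (real d - 1) * real k) * real N"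
    "\<And>a b l. (a, b) \<in> filled_julia av F1 F2 \<Longrightarrow> l < N \<Longrightarrow>
      av (\<Sum>m<N. C l m * a ^ m * b ^ (N - 1 - m)) \<le> R ^ h"
    using iterate_basis_exists[OF f g d lowest(2), of t "filled_julia av F1 F2" R k] KS KR assms(5)
    unfolding \<rho>_eq assms(8) h_def by fastforce
  have N: "N > 0" using assms(5,8) d by simp
  have \<alpha>h: "\<alpha> = real h"
    using assms(2,5,12) by (simp add: h_def of_nat_diff)
  define x y where "x i = fst (z (Suc i))" and "y i = snd (z (Suc i))" for i
  have xy: "z (Suc i) = (x i, y i)" "x i \<noteq> 0 \<or> y i \<noteq> 0" "(x i, y i) \<in> filled_julia av F1 F2"
    if "i < N" for i
    using assms(9,10)[of "Suc i"] that by (auto simp: x_def y_def prod_eq_iff)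
  have wedge: "wedge (z (Suc i)) (z (Suc j)) \<noteq> 0" if "j < i" "i < N" for i j
  proof (rule wedge_nonzero)
    show "proj_point (z (Suc i)) \<noteq> proj_point (z (Suc j))"
      using inj_onD[OF assms(11), of "Suc i" "Suc j"] that by auto
  qed (use assms(9)[of "Suc i"] assms(9)[of "Suc j"] that in auto)
  \<comment> \<open>Since N > 0, the filled Julia set has a nonzero point, so ln R is a genuine
    logarithm.\<close>
  have R: "R > 0"
  proof -
    have "vnorm av (x 0, y 0) > 0"
      using xy(2)[OF N] by (auto simp: vnorm_def less_max_iff_disj av_pos)
    then show ?thesis using K[OF xy(3)[OF N]] by linarith
  qed
  \<comment> \<open>Rows are monomials and columns are points, so \<open>H\<close> is the matrix
    product of \<open>C\<close> and \<open>V\<close>.\<close>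
  define V where "V m i = x i ^ m * y i ^ (N - 1 - m)" for m i
  define H where "H l i = (\<Sum>m<N. C l m * V m i)" for l i
  have "av (fdet N V) = (\<Prod>i<N. \<Prod>j<i. av (x i * y j - y i * x j))"
    unfolding fdet_transpose[of N V, symmetric] V_def
    by (rule av_fdet_vandermonde) (use xy in auto)
  also have "\<dots> = (\<Prod>i<N. \<Prod>j<i. av (wedge (z (Suc i)) (z (Suc j))))"
    by (simp add: wedge_def x_def y_def)
  finally have V: "av (fdet N V) = (\<Prod>i<N. \<Prod>j<i. av (wedge (z (Suc i)) (z (Suc j))))" .
  define W where "W = (\<Sum>i<N. \<Sum>j<i. ln (av (wedge (z (Suc i)) (z (Suc j)))))"
  have "ln (av (fdet N V)) = (\<Sum>i<N. ln (\<Prod>j<i. av (wedge (z (Suc i)) (z (Suc j)))))"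
    unfolding V by (rule ln_prod) (auto intro!: prod_pos av_pos simp: wedge)
  also have "\<dots> = W" unfolding W_def
    by (intro sum.cong refl ln_prod) (auto simp: wedge)
  finally have lnV: "ln (av (fdet N V)) = W" .
  have Vpos: "av (fdet N V) > 0" unfolding V by (auto intro!: prod_pos av_pos simp: wedge)
  have H: "av (fdet N H) = av \<rho> ^ e * av (fdet N V)"
    unfolding H_def[abs_def] fdet_mult av_mult C(1) ..
  have \<rho>pos: "av \<rho> > 0" using \<rho> by (rule av_pos)
  have "fdet N H \<noteq> 0" using H Vpos \<rho>pos av_zero
    by (metis mult_pos_pos less_irrefl zero_less_power)
  moreover have "av (H l i) \<le> R ^ h" if "l < N" "i < N" for l i
    using C(3)[OF xy(3)[OF that(2)] that(1)] by (simp add: H_def V_def mult.assoc)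
  ultimately have "2 * ln (av (fdet N H)) \<le> eps av * real N * ln (real N) + 2 * real N * ln (R ^ h)"
    using R N by (intro ln_av_fdet_le) auto
  moreover have "ln (av (fdet N H)) = real e * ln (av \<rho>) + W"
    unfolding H lnV[symmetric] using \<rho>pos Vpos by (subst ln_mult_pos) (simp_all add: ln_realpow)
  moreover have "ln (R ^ h) = \<alpha> * ln R" using R by (simp add: ln_realpow \<alpha>h)
  ultimately have main: "- 2 * W \<ge> 2 * real e * ln (av \<rho>) - eps av * real N * ln (real N) - 2 * ln R * \<alpha> * real N"
    by (simp add: algebra_simps)
  have "(\<Sum>(i, j) \<in> {(i, j). i \<in> {1..N} \<and> j \<in> {1..N} \<and> i \<noteq> j}. - ln (av (wedge (z i) (z j)))) =
    2 * (\<Sum>i<N. \<Sum>j<i. - ln (av (wedge (z (Suc i)) (z (Suc j)))))"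
  proof (rule sum_off_diagonal)
    fix i j
    have "wedge (z i) (z j) = - wedge (z j) (z i)" by (simp add: wedge_def algebra_simps)
    then show "- ln (av (wedge (z i) (z j))) = - ln (av (wedge (z j) (z i)))" by simp
  qed
  also have "\<dots> = - 2 * W" by (simp add: W_def sum_negf)
  finally have sum: "(\<Sum>(i, j) \<in> {(i, j). i \<in> {1..N} \<and> j \<in> {1..N} \<and> i \<noteq> j}. - ln (av (wedge (z i) (z j)))) = - 2 * W" .
  \<comment> \<open>Here t + (d-1)k = 1 + \<alpha>, and division by d(d-1) produces the
    normalisation of \<open>r_const\<close>.\<close>
  have "2 * real e = (real N ^ 2 - (1 + \<alpha>) * real N) / (real d * (real d - 1))"
    using C(2) assms(2) unfolding assms(12) by (simp add: field_simps)
  then have "2 * real e * ln (av \<rho>) = r_const av d F1 F2 * (real N ^ 2 - (1 + \<alpha>) * real N)"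
    by (simp add: r_const_def \<rho>_def)
  then have "2 * real e * ln (av \<rho>) = r_const av d F1 F2 * real N ^ 2 - r_const av d F1 F2 * (1 + \<alpha>) * real N"
    by (simp only: right_diff_distrib mult.assoc)
  then have ineq: "- 2 * W \<ge> r_const av d F1 F2 * real N ^ 2 - eps av * real N * ln (real N)
      - 2 * ln R * \<alpha> * real N - r_const av d F1 F2 * (1 + \<alpha>) * real N"
    using main by simp
  \<comment> \<open>Since (d-1)k \<ge> 1, \<alpha> is at least t.\<close>
  have "1 * 1 \<le> (real d - 1) * real k" using assms(2,7) by (intro mult_mono) auto
  then have \<alpha>2: "2 \<le> \<alpha>" using assms(5,12) by simp
  \<comment> \<open>The upper bound combines t - 1 \<le> 2(d-1) with k \<le> log_d N.\<close>
  have "log (real d) (real N) = log (real d) (real t) + real k"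
    using assms(2,5,8) by (simp add: log_mult log_nat_power)
  moreover have "log (real d) (real t) \<ge> 0" using assms(2,5) by simp
  ultimately have "(real d - 1) * (real k + 2) \<le> (real d - 1) * (log (real d) (real N) + 2)"
    using assms(2) by (intro mult_left_mono) auto
  moreover have "\<alpha> \<le> (real d - 1) * (real k + 2)"
    using assms(2,6,12) by (simp add: algebra_simps)
  ultimately have "\<alpha> \<le> (real d - 1) * (log (real d) (real N) + 2)" by simp
  then show ?thesis using ineq \<alpha>2 unfolding sum R_def by simp
qed

end
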